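(* For a positive integer $n$, let $f(n)$ denote the maximum of $f(H)$ over all graphs $H$ on $n$ vertices, where for an $n$-vertex graph $H$, \[ f(H) := \frac{|\{ G \,:\, G \subseteq^* H\}|}{2^{\binom{n}{2}} / n!}, \] the numerator counting isomorphism classes of graphs $G$ that are unique subgraphs of $H$. Then \[ \lim_{n \to \infty} f(n) = 0. \]
   Context: All graphs are finite and simple. A subgraph of a graph $H$ consists of a subset of its vertices together with a subset of its edges among those vertices. A graph $G$ is a unique subgraph of $H$, written $G \subseteq^* H$, if $H$ contains exactly one subgraph isomorphic to $G$. The count in the numerator of $f(H)$ is over non-isomorphic (unlabelled) graphs $G$ (of any number of vertices, necessarily at most $n$) with $G \subseteq^* H$. *)

theory Defs
  imports Complex_Main
begin

text \<open>
  A simple graph is a pair of a vertex set and a set of edges, each edge being a two-element set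
  of vertices. Isomorphism classes are taken inside the infinite type \<^typ>\<open>nat\<close>, in which every
  finite graph has an isomorphic copy.
\<close>

type_synonym 'a ugraph = "'a set \<times> 'a set set"

abbreviation verts :: "'a ugraph \<Rightarrow> 'a set" where "verts \<equiv> fst"
abbreviation edges :: "'a ugraph \<Rightarrow> 'a set set" where "edges \<equiv> snd"

definition is_graph :: "'a ugraph \<Rightarrow> bool" where
  "is_graph G \<longleftrightarrow> finite (verts G) \<and> edges G \<subseteq> {e. e \<subseteq> verts G \<and> card e = 2}"

definition is_subgraph :: "'a ugraph \<Rightarrow> 'a ugraph \<Rightarrow> bool" where
  "is_subgraph S H \<longleftrightarrow> is_graph S \<and> verts S \<subseteq> verts H \<and> edges S \<subseteq> edges H"

definition isomorphic :: "'a ugraph \<Rightarrow> 'b ugraph \<Rightarrow> bool" where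
  "isomorphic G H \<longleftrightarrow>
     (\<exists>\<phi>. bij_betw \<phi> (verts G) (verts H) \<and>
          (\<forall>u\<in>verts G. \<forall>v\<in>verts G. {u, v} \<in> edges G \<longleftrightarrow> {\<phi> u, \<phi> v} \<in> edges H))"

definition unique_subgraph :: "'a ugraph \<Rightarrow> 'b ugraph \<Rightarrow> bool"  (infix \<open>\<subseteq>\<^sup>*\<close> 50) where
  "G \<subseteq>\<^sup>* H \<longleftrightarrow> (\<exists>!S. is_subgraph S H \<and> isomorphic S G)"

definition iso_rel :: "(nat ugraph \<times> nat ugraph) set" where
  "iso_rel = {(G, G'). is_graph G \<and> is_graph G' \<and> isomorphic G G'}"

definition unique_subgraph_classes :: "nat ugraph \<Rightarrow> nat ugraph set set" where
  "unique_subgraph_classes H = {G. is_graph G \<and> G \<subseteq>\<^sup>* H} // iso_rel"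

definition unique_subgraph_ratio :: "nat ugraph \<Rightarrow> real" where
  "unique_subgraph_ratio H =
     real (card (unique_subgraph_classes H)) /
       (2 ^ (card (verts H) choose 2) / fact (card (verts H)))"

definition max_unique_subgraph_ratio :: "nat \<Rightarrow> real" where
  "max_unique_subgraph_ratio n =
     Max {unique_subgraph_ratio H | H. is_graph H \<and> card (verts H) = n}"

text \<open>
  The quotient, the cardinality and the maximum above are the genuine ones: isomorphism is an
  equivalence on graphs, being a unique subgraph is invariant under it, and the sets counted and
  maximised over are finite (and the latter nonempty).
\<close>

lemma isomorphic_refl: "isomorphic G G"
  unfolding isomorphic_def by (rule exI[of _ id]) auto

lemma isomorphic_sym:
  assumes "isomorphic G H"
  shows "isomorphic H G"
proof -
  obtain \<phi> where b: "bij_betw \<phi> (verts G) (verts H)"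
    and e: "\<forall>u\<in>verts G. \<forall>v\<in>verts G. {u, v} \<in> edges G \<longleftrightarrow> {\<phi> u, \<phi> v} \<in> edges H"
    using assms unfolding isomorphic_def by blast
  let ?\<psi> = "the_inv_into (verts G) \<phi>"
  have b': "bij_betw ?\<psi> (verts H) (verts G)"
    using b by (rule bij_betw_the_inv_into)
  have in': "?\<psi> u \<in> verts G" "\<phi> (?\<psi> u) = u" if "u \<in> verts H" for u
    using b b' that by (auto simp: bij_betw_def f_the_inv_into_f)
  have "\<forall>u\<in>verts H. \<forall>v\<in>verts H. {u, v} \<in> edges H \<longleftrightarrow> {?\<psi> u, ?\<psi> v} \<in> edges G"
    using e in' by simp
  with b' show ?thesis unfolding isomorphic_def by blast
qed

lemma isomorphic_trans:
  assumes "isomorphic G H" "isomorphic H K"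
  shows "isomorphic G K"
proof -
  obtain \<phi> where b: "bij_betw \<phi> (verts G) (verts H)"
    and e: "\<forall>u\<in>verts G. \<forall>v\<in>verts G. {u, v} \<in> edges G \<longleftrightarrow> {\<phi> u, \<phi> v} \<in> edges H"
    using assms(1) unfolding isomorphic_def by blast
  obtain \<psi> where b': "bij_betw \<psi> (verts H) (verts K)"
    and e': "\<forall>u\<in>verts H. \<forall>v\<in>verts H. {u, v} \<in> edges H \<longleftrightarrow> {\<psi> u, \<psi> v} \<in> edges K"
    using assms(2) unfolding isomorphic_def by blast
  have c: "bij_betw (\<psi> \<circ> \<phi>) (verts G) (verts K)"
    using b b' by (rule bij_betw_trans)
  have "\<forall>u\<in>verts G. \<phi> u \<in> verts H" using b by (auto simp: bij_betw_def)
  then have "\<forall>u\<in>verts G. \<forall>v\<in>verts G. {u, v} \<in> edges G \<longleftrightarrow> {(\<psi> \<circ> \<phi>) u, (\<psi> \<circ> \<phi>) v} \<in> edges K"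
    using e e' by simp
  with c show ?thesis unfolding isomorphic_def by blast
qed

lemma equiv_iso_rel: "equiv {G. is_graph G} iso_rel"
  by (rule equivI)
    (auto simp: iso_rel_def refl_on_def sym_def trans_def
      intro: isomorphic_refl isomorphic_sym isomorphic_trans)

lemma unique_subgraph_iso_cong:
  assumes "isomorphic G G'"
  shows "G \<subseteq>\<^sup>* H \<longleftrightarrow> G' \<subseteq>\<^sup>* H"
proof -
  have "isomorphic S G \<longleftrightarrow> isomorphic S G'" for S :: "'c ugraph"
    using assms isomorphic_sym isomorphic_trans by metis
  then show ?thesis by (simp add: unique_subgraph_def)
qed

lemma subgraphs_subset:
  assumes "is_graph H"
  shows "{S. is_subgraph S H} \<subseteq> Pow (verts H) \<times> Pow (Pow (verts H))"
  using assms unfolding is_subgraph_def is_graph_def by fastforce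

lemma unique_subgraph_classes_bound:
  assumes "is_graph H"
  shows "finite (unique_subgraph_classes H)"
    and "card (unique_subgraph_classes H) \<le> 2 ^ card (verts H) * 2 ^ (2 ^ card (verts H))"
proof -
  let ?P = "Pow (verts H) \<times> Pow (Pow (verts H))"
  have fin: "finite (verts H)" using assms by (simp add: is_graph_def)
  have sub: "unique_subgraph_classes H \<subseteq> (\<lambda>S. iso_rel `` {S}) ` ?P"
  proof
    fix C assume "C \<in> unique_subgraph_classes H"
    then obtain G where G: "is_graph G" "G \<subseteq>\<^sup>* H" "C = iso_rel `` {G}"
      unfolding unique_subgraph_classes_def by (auto elim: quotientE)
    then obtain S where S: "is_subgraph S H" "isomorphic S G"
      unfolding unique_subgraph_def by blast
    then have "(S, G) \<in> iso_rel"
      using G(1) by (simp add: iso_rel_def is_subgraph_def)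
    then have "C = iso_rel `` {S}"
      using G(3) equiv_class_eq[OF equiv_iso_rel] by blast
    moreover have "S \<in> ?P" using subgraphs_subset[OF assms] S(1) by blast
    ultimately show "C \<in> (\<lambda>S. iso_rel `` {S}) ` ?P" by blast
  qed
  have finP: "finite ?P" using fin by simp
  show "finite (unique_subgraph_classes H)"
    using sub finP by (meson finite_imageI finite_subset)
  have "card (unique_subgraph_classes H) \<le> card ?P"
    using sub finP by (meson surj_card_le)
  then show "card (unique_subgraph_classes H) \<le> 2 ^ card (verts H) * 2 ^ (2 ^ card (verts H))"
    using fin by (simp add: card_cartesian_product card_Pow)
qed

lemma unique_subgraph_ratios_finite:
  "finite {unique_subgraph_ratio H | H. is_graph H \<and> card (verts H) = n}"
proof (rule finite_subset)
  show "{unique_subgraph_ratio H | H. is_graph H \<and> card (verts H) = n}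
      \<subseteq> (\<lambda>k. real k / (2 ^ (n choose 2) / fact n)) ` {..2 ^ n * 2 ^ (2 ^ n)}"
  proof
    fix x assume "x \<in> {unique_subgraph_ratio H | H. is_graph H \<and> card (verts H) = n}"
    then obtain H where H: "x = unique_subgraph_ratio H" "is_graph H" "card (verts H) = n"
      by blast
    show "x \<in> (\<lambda>k. real k / (2 ^ (n choose 2) / fact n)) ` {..2 ^ n * 2 ^ (2 ^ n)}"
    proof (rule image_eqI)
      show "x = real (card (unique_subgraph_classes H)) / (2 ^ (n choose 2) / fact n)"
        unfolding H(1) unique_subgraph_ratio_def H(3) ..
      show "card (unique_subgraph_classes H) \<in> {..2 ^ n * 2 ^ (2 ^ n)}"
        using unique_subgraph_classes_bound(2)[OF H(2)] by (simp add: H(3))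
    qed
  qed
qed simp

lemma unique_subgraph_ratios_nonempty:
  "{unique_subgraph_ratio H | H. is_graph H \<and> card (verts H) = n} \<noteq> {}"
proof -
  have "is_graph ({..<n}, {}) \<and> card (verts ({..<n}, {})) = n"
    by (simp add: is_graph_def)
  then show ?thesis by blast
qed

end

theory Submission
  imports Defs "HOL-Combinatorics.Permutations" "HOL-Library.Disjoint_Sets" "HOL-Real_Asymp.Real_Asymp"
begin

text \<open>
  Fix the host graph \<open>H\<close> on \<open>n\<close> vertices and let \<open>F\<close> be its complement. Up to a negligible
  contribution of graphs with nontrivial automorphisms (bounded as in Polya's theorem), the ratio is at most twice the
  probability that a uniformly random labelled graph \<open>G\<close> has exactly one embedding \<open>\<sigma>\<close> into \<open>H\<close>.

  If \<open>F\<close> has more than \<open>K n\<close> edges, then each of the edges of \<open>\<sigma>\<inverse> F\<close> is pivotal for the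
  monotone property of being embeddable into \<open>H\<close>. A monotone property of subsets of a set of size \<open>N\<close>
  has at most \<open>sqrt N\<close> pivotal elements on average, so the probability is at most
  \<open>sqrt (n choose 2) / (K n) \<le> 1 / K\<close>.

  If \<open>F\<close> has at most \<open>K n\<close> edges, then at least half of the vertices have degree at most \<open>4 K\<close>
  in \<open>F\<close>. Uniqueness of \<open>\<sigma>\<close> means that for no two vertices \<open>u\<close>, \<open>v\<close> the copy \<open>\<sigma> G\<close>
  avoids the at most \<open>8 K\<close> edges that \<open>(u v) F\<close> has outside \<open>F\<close>. Splitting independent vertices of low degree into
  sunflowers of neighbourhoods, each with about \<open>(ln n)\<^sup>2\<close> petals, yields about \<open>n (ln n)\<^sup>2\<close> pairs for which these
  edge sets are pairwise disjoint, and the resulting probability beats the union bound over \<open>n!\<close> embeddings.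
\<close>

section \<open>Subsets of a finite set\<close>

lemma sum_square_deviation_card:
  assumes "finite P"
  shows "(\<Sum>G\<in>Pow P. (real (card P) - 2 * real (card G))\<^sup>2) = real (card P) * 2 ^ card P"
  using assms
proof (induction P rule: finite_induct)
  case (insert x P)
  have inj: "inj_on (insert x) (Pow P)"
    using insert.hyps(2) by (intro inj_onI) (metis PowD insert_ident subsetD)
  have disj: "Pow P \<inter> insert x ` Pow P = {}"
    using insert.hyps(2) by auto
  have c: "card (insert x G) = Suc (card G)" if "G \<in> Pow P" for G
    using that insert.hyps by (metis PowD card_insert_disjoint finite_subset in_mono)
  let ?a = "\<lambda>G. real (card P) - 2 * real (card G)"
  have "(\<Sum>G\<in>Pow (insert x P). (real (card (insert x P)) - 2 * real (card G))\<^sup>2)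
      = (\<Sum>G\<in>Pow P. (?a G + 1)\<^sup>2) + (\<Sum>G\<in>insert x ` Pow P. (?a G + 1)\<^sup>2)"
    using insert.hyps disj by (subst Pow_insert, subst sum.union_disjoint) (auto simp: algebra_simps)
  also have "(\<Sum>G\<in>insert x ` Pow P. (?a G + 1)\<^sup>2) = (\<Sum>G\<in>Pow P. (?a G - 1)\<^sup>2)"
    by (subst sum.reindex[OF inj], rule sum.cong) (auto simp: c algebra_simps)
  \<comment> \<open>The deviation is a sum of independent signs: subsets without and with
    \<open>x\<close> shift it by +1 and -1, so the cross terms cancel and the variance grows by
    1.\<close>
  also have "(\<Sum>G\<in>Pow P. (?a G + 1)\<^sup>2) + (\<Sum>G\<in>Pow P. (?a G - 1)\<^sup>2)
      = (\<Sum>G\<in>Pow P. 2 * (?a G)\<^sup>2 + 2)"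
    by (subst sum.distrib[symmetric], rule sum.cong) (auto simp: power2_eq_square algebra_simps)
  also have "\<dots> = real (card (insert x P)) * 2 ^ card (insert x P)"
    using insert.hyps insert.IH
    by (simp add: sum.distrib sum_distrib_left[symmetric] card_Pow algebra_simps)
  finally show ?case .
qed simp

text \<open>The first moment is at most the root of the second. The inequality is applied pointwise
  as AM-GM, with \<open>s\<close> the standard deviation, so that both terms contribute
  equally.\<close>

lemma sum_abs_deviation_card:
  assumes "finite P"
  shows "(\<Sum>G\<in>Pow P. \<bar>real (card P) - 2 * real (card G)\<bar>) \<le> sqrt (card P) * 2 ^ card P"
proof (cases "P = {}")
  case False
  define s where "s = sqrt (card P)"
  have s: "s > 0" "s * s = card P" using False assms by (auto simp: s_def card_gt_0_iff)
  have amgm: "\<bar>a\<bar> \<le> (a\<^sup>2 / s + s) / 2" for a :: real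
  proof -
    have "0 \<le> (\<bar>a\<bar> - s)\<^sup>2" by simp
    then have "2 * \<bar>a\<bar> * s \<le> a\<^sup>2 + s * s" by (simp add: power2_eq_square algebra_simps)
    then show ?thesis using s(1) by (simp add: field_simps)
  qed
  have "(\<Sum>G\<in>Pow P. \<bar>real (card P) - 2 * real (card G)\<bar>)
      \<le> (\<Sum>G\<in>Pow P. ((real (card P) - 2 * real (card G))\<^sup>2 / s + s) / 2)"
    by (intro sum_mono amgm)
  also have "\<dots> = ((\<Sum>G\<in>Pow P. (real (card P) - 2 * real (card G))\<^sup>2) / s + s * 2 ^ card P) / 2"
    using assms by (simp add: sum.distrib sum_divide_distrib[symmetric] card_Pow)
  also have "\<dots> = s * 2 ^ card P"
    using s unfolding sum_square_deviation_card[OF assms] using s by (simp add: field_simps)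
  finally show ?thesis by (simp add: s_def)
qed simp

text \<open>Each pair \<open>(G, x)\<close> with \<open>x \<notin> G\<close> and \<open>insert x G\<close> in the down-set corresponds to an element
  of \<open>insert x G\<close>, so the edge boundary telescopes to a sum of deviations from the mean.\<close>

lemma downset_edge_boundary:
  assumes "finite P" and sub: "\<D> \<subseteq> Pow P"
    and down: "\<And>x G. insert x G \<in> \<D> \<Longrightarrow> G \<in> \<D>"
  shows "real (\<Sum>G\<in>\<D>. card {x \<in> P - G. insert x G \<notin> \<D>}) \<le> sqrt (card P) * 2 ^ card P"
proof -
  have fin: "finite \<D>" using assms finite_subset by blast
  have finG: "finite G" "G \<subseteq> P" if "G \<in> \<D>" for G using that assms finite_subset by blast+
  let ?X = "SIGMA G:\<D>. {x \<in> P - G. insert x G \<in> \<D>}"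
  have "bij_betw (\<lambda>(G, x). (insert x G, x)) ?X (SIGMA G:\<D>. G)"
  proof (rule bij_betw_byWitness[where f' = "\<lambda>(G, x). (G - {x}, x)"])
    show "(\<lambda>(G, x). (G - {x}, x)) ` (SIGMA G:\<D>. G) \<subseteq> ?X"
      proof clarify
      fix G x assume *: "G \<in> \<D>" "x \<in> G"
      then have "insert x (G - {x}) \<in> \<D>" by (simp add: insert_absorb)
      then show "G - {x} \<in> \<D> \<and> x \<in> {y \<in> P - (G - {x}). insert y (G - {x}) \<in> \<D>}"
        using * sub down[of x "G - {x}"] by auto
    qed
  qed auto
  then have "card ?X = card (SIGMA G:\<D>. G)" by (rule bij_betw_same_card)
  then have eq: "(\<Sum>G\<in>\<D>. card {x \<in> P - G. insert x G \<in> \<D>}) = (\<Sum>G\<in>\<D>. card G)"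
    using fin finG assms(1) by (subst (asm) (1 2) card_SigmaI) auto
  have "card {x \<in> P - G. insert x G \<notin> \<D>} + card {x \<in> P - G. insert x G \<in> \<D>} + card G = card P"
    if "G \<in> \<D>" for G
  proof -
    have "card {x \<in> P - G. insert x G \<notin> \<D>} + card {x \<in> P - G. insert x G \<in> \<D>} = card (P - G)"
      using assms(1) by (subst card_Un_disjoint[symmetric]) (auto intro: arg_cong[where f = card])
    moreover have "card (P - G) + card G = card P"
      using finG[OF that] assms(1) by (simp add: card_Diff_subset card_mono)
    ultimately show ?thesis by simp
  qed
  then have "real (card {x \<in> P - G. insert x G \<notin> \<D>}) + real (card {x \<in> P - G. insert x G \<in> \<D>})
      + real (card G) = real (card P)" if "G \<in> \<D>" for G using that by (simp only: flip: of_nat_add)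
  \<comment> \<open>The second bracket need not vanish for a single \<open>G\<close>, but by
    \<open>eq\<close> its sum over \<open>\<D>\<close> does.\<close>
  then have "real (card {x \<in> P - G. insert x G \<notin> \<D>})
      = (real (card P) - 2 * real (card G)) + (real (card G) - real (card {x \<in> P - G. insert x G \<in> \<D>}))"
    if "G \<in> \<D>" for G using that by fastforce
  then have "real (\<Sum>G\<in>\<D>. card {x \<in> P - G. insert x G \<notin> \<D>})
      = (\<Sum>G\<in>\<D>. real (card P) - 2 * real (card G))
        + (real (\<Sum>G\<in>\<D>. card G) - real (\<Sum>G\<in>\<D>. card {x \<in> P - G. insert x G \<in> \<D>}))"
    by (simp add: sum.distrib sum_subtractf sum_distrib_left)
  also have "\<dots> = (\<Sum>G\<in>\<D>. real (card P) - 2 * real (card G))" by (simp only: eq)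
  also have "\<dots> \<le> (\<Sum>G\<in>\<D>. \<bar>real (card P) - 2 * real (card G)\<bar>)"
    by (intro sum_mono) simp
  also have "\<dots> \<le> (\<Sum>G\<in>Pow P. \<bar>real (card P) - 2 * real (card G)\<bar>)"
    using assms by (intro sum_mono2) auto
  also have "\<dots> \<le> sqrt (card P) * 2 ^ card P" by (rule sum_abs_deviation_card[OF assms(1)])
  finally show ?thesis .
qed

text \<open>For a random \<open>G\<close> the traces on disjoint sets are independent, and
  \<open>D i\<close> is missed with probability at least \<open>1 / 2 ^ c\<close>. The induction
  splits \<open>G\<close> into its trace on \<open>D j\<close> and the rest.\<close>

lemma card_sets_hitting_disjoint_family:
  assumes "finite I" "finite P" "\<And>i. i \<in> I \<Longrightarrow> D i \<subseteq> P" "disjoint_family_on D I"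
    and "\<And>i. i \<in> I \<Longrightarrow> card (D i) \<le> c"
  shows "real (card {G \<in> Pow P. \<forall>i\<in>I. G \<inter> D i \<noteq> {}}) \<le> 2 ^ card P * (1 - 1 / 2 ^ c) ^ card I"
  using assms
proof (induction I arbitrary: P rule: finite_induct)
  case empty
  then show ?case using card_Pow[of P] by (simp add: Pow_def)
next
  case (insert j I)
  let ?h = "\<lambda>P. {G \<in> Pow P. \<forall>i\<in>I. G \<inter> D i \<noteq> {}}"
  let ?h' = "{G \<in> Pow P. \<forall>i\<in>insert j I. G \<inter> D i \<noteq> {}}"
  have Dj: "D j \<subseteq> P" "finite (D j)" "card (D j) \<le> c"
    using insert.prems(2,4)[of j] finite_subset[OF _ insert.prems(1)] by auto
  have dis: "D i \<inter> D j = {}" if "i \<in> I" for i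
    using that insert.hyps insert.prems(3) by (auto simp: disjoint_family_on_def)
  have IH: "real (card (?h (P - D j))) \<le> 2 ^ card (P - D j) * (1 - 1 / 2 ^ c) ^ card I"
    proof (rule insert.IH)
    show "D i \<subseteq> P - D j" if "i \<in> I" for i using dis[OF that] insert.prems(2)[of i] that by blast
    show "disjoint_family_on D I" using insert.prems(3) by (auto simp: disjoint_family_on_def)
  qed (use insert.prems(1,4) in auto)
  have "card ?h' \<le> card ((Pow (D j) - {{}}) \<times> ?h (P - D j))"
  proof (rule card_inj_on_le)
    show "inj_on (\<lambda>G. (G \<inter> D j, G - D j)) ?h'" by (auto simp: inj_on_def)
    show "(\<lambda>G. (G \<inter> D j, G - D j)) ` ?h' \<subseteq> (Pow (D j) - {{}}) \<times> ?h (P - D j)"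
    proof (intro image_subsetI SigmaI)
      fix G assume "G \<in> ?h'"
      moreover have "(G - D j) \<inter> D i = G \<inter> D i" if "i \<in> I" for i using dis[OF that] by blast
      ultimately show "G \<inter> D j \<in> Pow (D j) - {{}}" "G - D j \<in> ?h (P - D j)" by auto
    qed
  qed (use Dj insert.prems(1) in auto)
  also have "\<dots> = (2 ^ card (D j) - 1) * card (?h (P - D j))"
    using Dj by (simp add: card_cartesian_product card_Pow card_Diff_subset)
  finally have "real (card ?h') \<le> real ((2 ^ card (D j) - 1) * card (?h (P - D j)))"
    by (simp only: of_nat_le_iff)
  also have "\<dots> = (2 ^ card (D j) - 1) * real (card (?h (P - D j)))" by (simp add: of_nat_diff)
  also have "\<dots> \<le> (2 ^ card (D j) - 1) * (2 ^ card (P - D j) * (1 - 1 / 2 ^ c) ^ card I)"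
    by (intro mult_left_mono IH) simp
  also have "\<dots> = (2 ^ card (D j) * 2 ^ card (P - D j)) * (1 - 1 / 2 ^ card (D j)) * (1 - 1 / 2 ^ c) ^ card I"
    by (simp add: field_simps)
  also have "2 ^ card (D j) * 2 ^ card (P - D j) = (2 :: real) ^ card P"
    using Dj insert.prems(1) by (simp flip: power_add add: card_Diff_subset card_mono)
  also have "2 ^ card P * (1 - 1 / 2 ^ card (D j)) * (1 - 1 / 2 ^ c) ^ card I
      \<le> 2 ^ card P * (1 - 1 / 2 ^ c) * (1 - 1 / 2 ^ c :: real) ^ card I"
    using Dj(3) by (intro mult_right_mono mult_left_mono diff_left_mono divide_left_mono power_increasing) auto
  finally show ?case using insert.hyps by (simp add: mult.assoc)
qed

section \<open>Sunflowers and their greedy extraction\<close>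

definition sunflower :: "('i \<Rightarrow> 'a set) \<Rightarrow> 'i set \<Rightarrow> bool" where
  "sunflower N J \<longleftrightarrow> (\<exists>Y. \<forall>i\<in>J. \<forall>j\<in>J. i \<noteq> j \<longrightarrow> N i \<inter> N j = Y)"

text \<open>The Erdos-Rado argument for indexed families, in which distinct indices may carry equal
  sets. A maximal disjoint subfamily either has \<open>p\<close> members, giving an empty kernel, or
  its union is small and meets all other sets. Then some point \<open>x\<close> lies in many sets;
  it is removed from them and joins the kernel found by induction.\<close>

lemma sunflower_exists:
  assumes "finite I" "\<And>i. i \<in> I \<Longrightarrow> finite (N i) \<and> card (N i) \<le> d"
    and "(p * (d + 1)) ^ (d + 1) \<le> card I" "p \<ge> 1"
  shows "\<exists>J\<subseteq>I. card J = p \<and> sunflower N J"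
  using assms
proof (induction d arbitrary: N I)
  case 0
  then have "p \<le> card I" by simp
  then obtain J where J: "J \<subseteq> I" "card J = p"
    using obtain_subset_with_card_n by metis
  have "N i = {}" if "i \<in> J" for i
    using 0(2)[OF subsetD[OF J(1) that]] card_0_eq by blast
  then show ?case using J by (auto simp: sunflower_def)
next
  case (Suc d)
  let ?c = "(p * (d + 1)) ^ (d + 1)"
  define \<J> where "\<J> = {J. J \<subseteq> I \<and> disjoint_family_on N J}"
  have "finite \<J>" unfolding \<J>_def using Suc.prems(1) by simp
  moreover have "{} \<in> \<J>" by (simp add: \<J>_def disjoint_family_on_def)
  ultimately obtain J where J: "J \<in> \<J>" and max: "\<forall>J'\<in>\<J>. J \<subseteq> J' \<longrightarrow> J = J'"
    by (metis finite_has_maximal empty_iff)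
  have finJ: "finite J" using J Suc.prems(1) finite_subset unfolding \<J>_def by blast
  show ?case
  proof (cases "card J \<ge> p")
    case True
    then obtain J' where "J' \<subseteq> J" "card J' = p" by (metis obtain_subset_with_card_n)
    moreover from this have "sunflower N J'" using J
      unfolding sunflower_def \<J>_def disjoint_family_on_def by (intro exI[of _ "{}"]) blast
    ultimately show ?thesis using J unfolding \<J>_def by blast
  next
    case False
    define U where "U = (\<Union>i\<in>J. N i)"
    have NJ: "finite (N i)" "card (N i) \<le> Suc d" if "i \<in> J" for i using Suc.prems(2)[of i] J that unfolding \<J>_def by blast+
    have finU: "finite U" using finJ NJ by (simp add: U_def)
    have cU: "card U \<le> p * Suc d"
    proof -
      have "card U \<le> (\<Sum>i\<in>J. card (N i))" unfolding U_def by (rule card_UN_le[OF finJ])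
      also have "\<dots> \<le> (\<Sum>i\<in>J. Suc d)" by (intro sum_mono NJ)
      also have "\<dots> \<le> p * Suc d" using False by (simp del: mult_Suc_right)
      finally show ?thesis .
    qed
    have cover: "I \<subseteq> J \<union> (\<Union>x\<in>U. {i \<in> I. x \<in> N i})"
    proof
      fix i assume i: "i \<in> I"
      show "i \<in> J \<union> (\<Union>x\<in>U. {i \<in> I. x \<in> N i})"
      proof (rule ccontr)
        assume *: "\<not> ?thesis"
        then have "insert i J \<in> \<J>" using i J by (auto simp: \<J>_def disjoint_family_on_def U_def)
        then have "J = insert i J" using max by blast
        then show False using * by blast
      qed
    qed
    have "\<exists>x\<in>U. ?c \<le> card {i \<in> I. x \<in> N i}"
    proof (rule ccontr)
      assume "\<not> ?thesis"
      then have le: "card {i \<in> I. x \<in> N i} \<le> ?c" if "x \<in> U" for x using that by force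
      have "card I \<le> card (J \<union> (\<Union>x\<in>U. {i \<in> I. x \<in> N i}))"
        using cover finJ finU Suc.prems(1) by (intro card_mono) auto
      also have "\<dots> \<le> card J + card (\<Union>x\<in>U. {i \<in> I. x \<in> N i})" by (rule card_Un_le)
      also have "card (\<Union>x\<in>U. {i \<in> I. x \<in> N i}) \<le> (\<Sum>x\<in>U. card {i \<in> I. x \<in> N i})"
        by (rule card_UN_le[OF finU])
      also have "\<dots> \<le> (\<Sum>x\<in>U. ?c)" by (intro sum_mono le)
      also have "\<dots> \<le> p * Suc d * ?c" using cU by simp
      also have "card J + p * Suc d * ?c < p + p * Suc d * ?c" using False by simp
      \<comment> \<open>Since \<open>?c\<close> is at least 1, the members of \<open>J\<close> are
        absorbed by raising the factor \<open>Suc d\<close> to \<open>Suc d + 1\<close>, which is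
        why the base of the bound grows with \<open>d\<close>.\<close>
      also have "\<dots> \<le> p * ?c + p * Suc d * ?c" using Suc.prems(4) by simp
      also have "\<dots> = p * (Suc d + 1) * ?c" by (simp add: algebra_simps)
      also have "\<dots> \<le> p * (Suc d + 1) * (p * (Suc d + 1)) ^ (d + 1)"
        by (intro mult_left_mono power_mono) auto
      also have "\<dots> = (p * (Suc d + 1)) ^ (Suc d + 1)" by simp
      finally show False using Suc.prems(3) by simp
    qed
    then obtain x where x: "?c \<le> card {i \<in> I. x \<in> N i}" by blast
    have "\<exists>J\<subseteq>{i \<in> I. x \<in> N i}. card J = p \<and> sunflower (\<lambda>i. N i - {x}) J"
    proof (rule Suc.IH)
      fix i assume "i \<in> {i \<in> I. x \<in> N i}"
      then show "finite (N i - {x}) \<and> card (N i - {x}) \<le> d"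
        using Suc.prems(2)[of i] by (auto simp: card_Diff_singleton)
    qed (use Suc.prems x in auto)
    then obtain J Y where J: "J \<subseteq> {i \<in> I. x \<in> N i}" "card J = p"
      and Y: "\<forall>i\<in>J. \<forall>j\<in>J. i \<noteq> j \<longrightarrow> (N i - {x}) \<inter> (N j - {x}) = Y"
      by (auto simp: sunflower_def)
    have "N i \<inter> N j = insert x Y" if "i \<in> J" "j \<in> J" "i \<noteq> j" for i j
    proof -
      have "N i \<inter> N j = insert x ((N i - {x}) \<inter> (N j - {x}))" using J(1) that by auto
      then show ?thesis using Y that by simp
    qed
    then have "sunflower N J" unfolding sunflower_def by blast
    then show ?thesis using J by blast
  qed
qed

text \<open>Greedy removal: as long as \<open>c\<close> elements remain, another set with property
  \<open>Q\<close> can be taken out.\<close>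

lemma disjoint_subsets_exhaust:
  assumes "finite L" "p \<ge> 1"
    and "\<And>L'. L' \<subseteq> L \<Longrightarrow> c \<le> card L' \<Longrightarrow> \<exists>J\<subseteq>L'. card J = p \<and> Q J"
  shows "\<exists>\<S>. finite \<S> \<and> disjoint \<S> \<and> (\<forall>S\<in>\<S>. S \<subseteq> L \<and> card S = p \<and> Q S) \<and> card L \<le> p * card \<S> + c"
  using assms
proof (induction "card L" arbitrary: L rule: less_induct)
  case less
  show ?case
  proof (cases "c \<le> card L")
    case False
    then show ?thesis by (intro exI[of _ "{}"]) auto
  next
    case True
    then obtain J where J: "J \<subseteq> L" "card J = p" "Q J" using less.prems(3)[of L] by blast
    have ne: "J \<noteq> {}" "finite J" using J less.prems(1,2) finite_subset by (auto)
    have cL: "card L = card (L - J) + p"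
      using J less.prems(1) ne by (metis add.commute card_Diff_subset card_mono le_add_diff_inverse)
    have "\<exists>\<S>. finite \<S> \<and> disjoint \<S> \<and> (\<forall>S\<in>\<S>. S \<subseteq> L - J \<and> card S = p \<and> Q S) \<and>
        card (L - J) \<le> p * card \<S> + c"
    proof (rule less.hyps)
      show "card (L - J) < card L" using cL less.prems(2) by simp
      fix L' assume "L' \<subseteq> L - J" "c \<le> card L'"
      then show "\<exists>J\<subseteq>L'. card J = p \<and> Q J" using less.prems(3)[of L'] by blast
    qed (use less.prems in auto)
    then obtain \<S> where S: "finite \<S>" "disjoint \<S>" "\<forall>S\<in>\<S>. S \<subseteq> L - J \<and> card S = p \<and> Q S"
      "card (L - J) \<le> p * card \<S> + c" by blast
    have "J \<notin> \<S>" using S(3) ne by blast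
    moreover have "disjoint (insert J \<S>)" using S(2,3) by (fastforce simp: disjoint_def)
    ultimately show ?thesis using S J cL
      by (intro exI[of _ "insert J \<S>"]) auto
  qed
qed

text \<open>Take a maximal set \<open>T\<close> of moved points that is disjoint from its image. An
  invariant set \<open>A\<close> is determined outside \<open>T\<close>, because \<open>x\<close> in
  \<open>T\<close> lies in \<open>A\<close> iff \<open>g x\<close> does, and \<open>g x\<close> is
  outside \<open>T\<close>. By maximality \<open>T\<close>, its image and its preimage cover the
  moved points, hence the 3.\<close>

lemma card_invariant_subsets:
  assumes "finite P" "bij_betw g P P"
  shows "real (card {A \<in> Pow P. g ` A = A}) \<le> 2 powr (card P - card {x \<in> P. g x \<noteq> x} / 3)"
proof -
  let ?M = "{x \<in> P. g x \<noteq> x}"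
  define \<T> where "\<T> = {T. T \<subseteq> ?M \<and> T \<inter> g ` T = {}}"
  have inj: "inj_on g P" using assms(2) by (simp add: bij_betw_def)
  have "finite \<T>" unfolding \<T>_def using assms(1) by simp
  moreover have "{} \<in> \<T>" by (simp add: \<T>_def)
  ultimately obtain T where T: "T \<in> \<T>" and max: "\<forall>T'\<in>\<T>. T \<subseteq> T' \<longrightarrow> T = T'"
    by (metis finite_has_maximal empty_iff)
  have TP: "T \<subseteq> P" using T by (auto simp: \<T>_def)
  have finT: "finite T" by (rule finite_subset[OF TP assms(1)])
  let ?R = "{x \<in> P. g x \<in> T}"
  have "card ?R \<le> card T"
    using finT inj by (intro card_inj_on_le[of g]) (auto simp: inj_on_def)
  moreover have "card (g ` T) \<le> card T" by (rule card_image_le[OF finT])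
  moreover have "?M \<subseteq> T \<union> g ` T \<union> ?R"
  proof (rule ccontr)
    assume "\<not> ?thesis"
    then obtain x where x: "x \<in> ?M" "x \<notin> T" "x \<notin> g ` T" "g x \<notin> T" by blast
    then have "insert x T \<in> \<T>" using T by (auto simp: \<T>_def)
    then have "T = insert x T" using max by blast
    then show False using x by blast
  qed
  then have "card ?M \<le> card (T \<union> g ` T \<union> ?R)"
    using finT assms(1) by (intro card_mono) auto
  moreover have "card (T \<union> g ` T \<union> ?R) \<le> card T + card (g ` T) + card ?R"
    by (metis (no_types, lifting) add_le_mono1 card_Un_le order_trans)
  ultimately have M: "card ?M \<le> 3 * card T" by simp
  have "card {A \<in> Pow P. g ` A = A} \<le> card (Pow (P - T))"
  proof (rule card_inj_on_le)
    show "inj_on (\<lambda>A. A - T) {A \<in> Pow P. g ` A = A}"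
    proof (rule inj_onI)
      fix A B assume A: "A \<in> {A \<in> Pow P. g ` A = A}" and B: "B \<in> {A \<in> Pow P. g ` A = A}"
        and eq: "A - T = B - T"
      have mem: "x \<in> C \<longleftrightarrow> g x \<in> C" if "x \<in> P" "C \<in> {A \<in> Pow P. g ` A = A}" for x C
        using that inj_on_image_mem_iff[OF inj, of x C] by simp
      have "x \<in> A \<longleftrightarrow> x \<in> B" if "x \<in> T" for x
      proof -
        have "g x \<notin> T" using that T by (auto simp: \<T>_def)
        then have "g x \<in> A \<longleftrightarrow> g x \<in> B" using eq by blast
        then show ?thesis using mem A B TP that by blast
      qed
      then show "A = B" using eq by blast
    qed
  qed (use assms(1) in auto)
  also have "\<dots> = 2 ^ (card P - card T)" using TP finT assms(1) by (simp add: card_Pow card_Diff_subset)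
  finally have "real (card {A \<in> Pow P. g ` A = A}) \<le> real (2 ^ (card P - card T))"
    by (simp only: of_nat_le_iff)
  also have "\<dots> = 2 ^ (card P - card T)" by simp
  also have "\<dots> = 2 powr (real (card P) - real (card T))"
    using card_mono[OF assms(1) TP] by (simp flip: powr_realpow add: of_nat_diff)
  also have "\<dots> \<le> 2 powr (card P - card ?M / 3)" using M by simp
  finally show ?thesis .
qed

section \<open>Permutations acting on graphs\<close>

definition all_pairs :: "'a set \<Rightarrow> 'a set set" where
  "all_pairs V = {e. e \<subseteq> V \<and> card e = 2}"

lemma finite_all_pairs: "finite V \<Longrightarrow> finite (all_pairs V)"
  by (simp add: all_pairs_def)

lemma card_all_pairs: "finite V \<Longrightarrow> card (all_pairs V) = card V choose 2"
  by (simp add: all_pairs_def n_subsets)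

lemma bij_betw_all_pairs:
  assumes "\<sigma> permutes V"
  shows "bij_betw ((`) \<sigma>) (all_pairs V) (all_pairs V)"
proof -
  have bij: "bij_betw ((`) \<sigma>) (Pow V) (Pow V)"
    by (rule bij_betw_image_Pow[OF permutes_imp_bij[OF assms]])
  have c: "card (\<sigma> ` e) = card e" for e
    by (rule card_image) (meson assms inj_on_subset permutes_inj subset_UNIV)
  have "(`) \<sigma> ` all_pairs V = all_pairs V"
  proof
    show "(`) \<sigma> ` all_pairs V \<subseteq> all_pairs V"
    proof (rule image_subsetI)
      fix e assume "e \<in> all_pairs V"
      then have "e \<subseteq> V" "card e = 2" by (auto simp: all_pairs_def)
      then show "\<sigma> ` e \<in> all_pairs V"
        using image_mono[of e V \<sigma>] permutes_image[OF assms] c by (simp add: all_pairs_def)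
    qed
    show "all_pairs V \<subseteq> (`) \<sigma> ` all_pairs V"
    proof
      fix e assume e: "e \<in> all_pairs V"
      then have "e \<in> (`) \<sigma> ` Pow V" using bij by (simp add: bij_betw_def all_pairs_def)
      then obtain e' where e': "e' \<subseteq> V" "e = \<sigma> ` e'" by blast
      then have "e' \<in> all_pairs V" using e c[of e'] by (simp add: all_pairs_def)
      then show "e \<in> (`) \<sigma> ` all_pairs V" using e'(2) by blast
    qed
  qed
  moreover have "inj_on ((`) \<sigma>) (all_pairs V)"
    by (rule inj_on_subset[OF bij_betw_imp_inj_on[OF bij]]) (auto simp: all_pairs_def)
  ultimately show ?thesis by (simp add: bij_betw_def)
qed

text \<open>If \<open>v\<close> is moved and \<open>w\<close> differs from \<open>v\<close> and
  \<open>\<sigma> v\<close>, the pair \<open>{v, w}\<close> is moved, as its image contains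
  \<open>\<sigma> v\<close>. Each pair arises at most once from each of its two endpoints.\<close>

lemma card_moved_pairs:
  assumes "finite V" "\<sigma> permutes V"
  shows "card {v \<in> V. \<sigma> v \<noteq> v} * (card V - 2) \<le> 2 * card {e \<in> all_pairs V. \<sigma> ` e \<noteq> e}"
proof -
  let ?M = "{v \<in> V. \<sigma> v \<noteq> v}" and ?E = "{e \<in> all_pairs V. \<sigma> ` e \<noteq> e}"
  have "card (SIGMA v:?M. V - {v, \<sigma> v}) \<le> card (SIGMA e:?E. e)"
  proof (rule card_inj_on_le)
    show "inj_on (\<lambda>(v, w). ({v, w}, v)) (SIGMA v:?M. V - {v, \<sigma> v})"
      by (auto simp: inj_on_def doubleton_eq_iff)
    show "(\<lambda>(v, w). ({v, w}, v)) ` (SIGMA v:?M. V - {v, \<sigma> v}) \<subseteq> (SIGMA e:?E. e)"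
      by (auto simp: all_pairs_def)
    show "finite (SIGMA e:?E. e)"
      using assms(1) finite_all_pairs[OF assms(1)] finite_subset
      by (intro finite_SigmaI) (auto simp: all_pairs_def)
  qed
  moreover have "card (SIGMA v:?M. V - {v, \<sigma> v}) = card ?M * (card V - 2)"
  proof -
    have "card (V - {v, \<sigma> v}) = card V - 2" if "v \<in> ?M" for v
      using that assms permutes_in_image[OF assms(2)] by (subst card_Diff_subset) auto
    then show ?thesis using assms(1) by (subst card_SigmaI) auto
  qed
  moreover have "card (SIGMA e:?E. e) = card ?E * 2"
  proof -
    have "finite e \<and> card e = 2" if "e \<in> ?E" for e
      using that assms(1) finite_subset by (auto simp: all_pairs_def)
    then show ?thesis using finite_all_pairs[OF assms(1)] by (subst card_SigmaI) auto
  qed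
  ultimately show ?thesis by simp
qed

text \<open>Enlarging the sum from permutations to all maps from \<open>V\<close> to itself makes
  the weight factor over the vertices. Restriction to \<open>V\<close> matches permutations, which
  are the identity outside \<open>V\<close>, with extensional functions.\<close>

lemma sum_permutes_power_moved:
  fixes x :: real
  assumes "finite V" "x \<ge> 0"
  shows "(\<Sum>\<sigma> | \<sigma> permutes V. x ^ card {v \<in> V. \<sigma> v \<noteq> v}) \<le> (1 + card V * x) ^ card V"
proof -
  let ?w = "\<lambda>g. \<Prod>v\<in>V. if g v = v then 1 else x"
  have w: "x ^ card {v \<in> V. \<sigma> v \<noteq> v} = ?w (restrict \<sigma> V)" for \<sigma>
  proof -
    have "?w (restrict \<sigma> V) = (\<Prod>v\<in>V. if \<sigma> v = v then 1 else x)" by (rule prod.cong) auto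
    also have "\<dots> = x ^ card {v \<in> V. \<sigma> v \<noteq> v}"
      using assms(1) by (simp add: prod.If_cases Int_def)
    finally show ?thesis by simp
  qed
  have inj: "inj_on (\<lambda>\<sigma>. restrict \<sigma> V) {\<sigma>. \<sigma> permutes V}"
  proof (rule inj_onI)
    fix \<sigma> \<tau> assume a: "\<sigma> \<in> {\<sigma>. \<sigma> permutes V}" "\<tau> \<in> {\<sigma>. \<sigma> permutes V}" "restrict \<sigma> V = restrict \<tau> V"
    then have "\<sigma> v = \<tau> v" for v
      by (cases "v \<in> V") (auto dest: fun_cong[where x = v] simp: permutes_not_in)
    then show "\<sigma> = \<tau>" by blast
  qed
  have "(\<Sum>\<sigma> | \<sigma> permutes V. x ^ card {v \<in> V. \<sigma> v \<noteq> v})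
      = (\<Sum>g\<in>(\<lambda>\<sigma>. restrict \<sigma> V) ` {\<sigma>. \<sigma> permutes V}. ?w g)"
    by (subst sum.reindex[OF inj]) (simp add: w)
  also have "\<dots> \<le> (\<Sum>g\<in>V \<rightarrow>\<^sub>E V. ?w g)"
  proof (rule sum_mono2)
    show "(\<lambda>\<sigma>. restrict \<sigma> V) ` {\<sigma>. \<sigma> permutes V} \<subseteq> V \<rightarrow>\<^sub>E V"
      by (auto simp: permutes_in_image)
  qed (use assms in \<open>auto intro!: finite_PiE prod_nonneg\<close>)
  also have "\<dots> = (\<Prod>v\<in>V. \<Sum>u\<in>V. if u = v then 1 else x)"
    using assms(1) by (subst prod_sum_PiE) auto
  also have "\<dots> \<le> (\<Prod>v\<in>V. 1 + card V * x)"
  proof (rule prod_mono, intro conjI)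
    fix v assume "v \<in> V"
    show "0 \<le> (\<Sum>u\<in>V. if u = v then 1 else x)" using assms by (intro sum_nonneg) auto
    have "(\<Sum>u\<in>V. if u = v then 1 else x) \<le> (\<Sum>u\<in>V. (if u = v then 1 else 0) + x)"
      using assms by (intro sum_mono) auto
    also have "\<dots> = 1 + card V * x" using assms(1) \<open>v \<in> V\<close> by (simp add: sum.distrib)
    finally show "(\<Sum>u\<in>V. if u = v then 1 else x) \<le> 1 + card V * x" .
  qed
  finally show ?thesis by simp
qed

text \<open>A permutation moving \<open>m\<close> vertices moves at least
  \<open>m * (card V - 2) / 2\<close> pairs, and a third of these are lost in the exponent; this
  gives the 6. The summand of the identity is the subtracted 1.\<close>

lemma sum_invariant_nonidentity:
  assumes "finite V" "card V \<ge> 2"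
  defines "N \<equiv> card (all_pairs V)"
  shows "(\<Sum>\<sigma> | \<sigma> permutes V \<and> \<sigma> \<noteq> id. real (card {G \<in> Pow (all_pairs V). (`) \<sigma> ` G = G}))
    \<le> 2 ^ N * ((1 + card V * 2 powr (- ((card V - 2) / 6))) ^ card V - 1)"
proof -
  define x :: real where "x = 2 powr (- ((card V - 2) / 6))"
  have x: "x > 0" by (simp add: x_def)
  let ?m = "\<lambda>\<sigma>. card {v \<in> V. \<sigma> v \<noteq> v}"
  let ?S = "{\<sigma>. \<sigma> permutes V}"
  have fin: "finite ?S" by (rule finite_permutations[OF assms(1)])
  have fix_le: "real (card {G \<in> Pow (all_pairs V). (`) \<sigma> ` G = G}) \<le> 2 ^ N * x ^ ?m \<sigma>" if "\<sigma> permutes V" for \<sigma>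
  proof -
    let ?k = "card {e \<in> all_pairs V. \<sigma> ` e \<noteq> e}"
    have "real (?m \<sigma> * (card V - 2)) \<le> real (2 * ?k)"
      using card_moved_pairs[OF assms(1) that] by (simp only: of_nat_le_iff)
    then have k: "?m \<sigma> * ((card V - 2) / 6) \<le> ?k / 3"
      using assms(2) by (simp add: of_nat_diff mult.commute)
    have "real (card {G \<in> Pow (all_pairs V). (`) \<sigma> ` G = G}) \<le> 2 powr (N - ?k / 3)"
      unfolding N_def
      by (rule card_invariant_subsets[OF finite_all_pairs[OF assms(1)] bij_betw_all_pairs[OF that]])
    also have "\<dots> \<le> 2 powr (N + (- ((card V - 2) / 6)) * ?m \<sigma>)"
      using k by (simp add: mult.commute)
    also have "\<dots> = 2 ^ N * x ^ ?m \<sigma>"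
      unfolding powr_add x_def by (simp add: powr_realpow powr_power mult.commute del: of_nat_diff)
    finally show ?thesis .
  qed
  have S: "{\<sigma>. \<sigma> permutes V \<and> \<sigma> \<noteq> id} = ?S - {id}" by auto
  have "(\<Sum>\<sigma>\<in>?S - {id}. real (card {G \<in> Pow (all_pairs V). (`) \<sigma> ` G = G}))
      \<le> (\<Sum>\<sigma>\<in>?S - {id}. 2 ^ N * x ^ ?m \<sigma>)"
    by (rule sum_mono) (use fix_le in auto)
  also have "(\<Sum>\<sigma>\<in>?S - {id}. 2 ^ N * x ^ ?m \<sigma>) = 2 ^ N * ((\<Sum>\<sigma>\<in>?S. x ^ ?m \<sigma>) - 1)"
    using fin by (simp add: sum_diff1 permutes_id sum_distrib_left[symmetric] right_diff_distrib)
  also have "\<dots> \<le> 2 ^ N * ((1 + card V * x) ^ card V - 1)"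
    using sum_permutes_power_moved[OF assms(1), of x] x by simp
  finally show ?thesis unfolding S x_def .
qed

section \<open>Embeddings of labelled graphs, given as edge sets on a fixed vertex set\<close>

definition embeddings :: "'a set \<Rightarrow> 'a set set \<Rightarrow> 'a set set \<Rightarrow> ('a \<Rightarrow> 'a) set" where
  "embeddings V H G = {\<sigma>. \<sigma> permutes V \<and> (`) \<sigma> ` G \<subseteq> H}"

text \<open>These are the edge sets of spanning unique subgraphs. Only the image is unique, so
  nontrivial automorphisms of \<open>E\<close> are allowed.\<close>

definition unique_copies :: "'a set \<Rightarrow> 'a set set \<Rightarrow> 'a set set set" where
  "unique_copies V H = {E \<in> Pow H. \<forall>\<sigma>\<in>embeddings V H E. (`) \<sigma> ` E = E}"

text \<open>Here the map itself is unique. This excludes nontrivial automorphisms, since composing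
  with one would give a second embedding.\<close>

definition uniquely_embedded :: "'a set \<Rightarrow> 'a set set \<Rightarrow> 'a set set set" where
  "uniquely_embedded V H = {G \<in> Pow (all_pairs V). \<exists>!\<sigma>. \<sigma> \<in> embeddings V H G}"

lemma image_image_comp: "(`) (\<sigma> \<circ> \<tau>) ` G = (`) \<sigma> ` (`) \<tau> ` G"
proof -
  have "(`) (\<sigma> \<circ> \<tau>) = (`) \<sigma> \<circ> (`) \<tau>" by (rule ext) (simp add: image_comp)
  then show ?thesis by (simp only: image_comp)
qed

lemma image_image_inv:
  assumes "\<sigma> permutes V"
  shows "(`) (inv \<sigma>) ` (`) \<sigma> ` G = G" "(`) \<sigma> ` (`) (inv \<sigma>) ` G = G"
  unfolding image_image_comp[symmetric] permutes_inv_o[OF assms] by simp_all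

lemma image_all_pairs_subset:
  assumes "\<sigma> permutes V" "G \<subseteq> all_pairs V"
  shows "(`) \<sigma> ` G \<subseteq> all_pairs V"
  using bij_betw_all_pairs[OF assms(1)] assms(2) unfolding bij_betw_def by blast

text \<open>\<open>\<tau> \<circ> inv \<sigma>\<close> embeds the unique copy
  \<open>\<sigma> G\<close>, so it preserves it, and \<open>\<tau> G = \<sigma> G\<close>. Hence all
  embeddings of \<open>G\<close> lie in one coset of its automorphism group.\<close>

lemma unique_copies_embedding_automorphism:
  assumes "\<sigma> permutes V" "(`) \<sigma> ` G \<in> unique_copies V H" "\<tau> \<in> embeddings V H G"
  shows "(`) (inv \<sigma> \<circ> \<tau>) ` G = G"
proof -
  have \<tau>: "\<tau> permutes V" "(`) \<tau> ` G \<subseteq> H" using assms(3) by (auto simp: embeddings_def)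
  have eq: "(`) (\<tau> \<circ> inv \<sigma>) ` (`) \<sigma> ` G = (`) \<tau> ` G"
    by (simp only: image_image_comp image_image_inv[OF assms(1)])
  then have "\<tau> \<circ> inv \<sigma> \<in> embeddings V H ((`) \<sigma> ` G)"
    using \<tau> assms(1) by (simp add: embeddings_def permutes_compose permutes_inv)
  moreover have "\<forall>\<rho>\<in>embeddings V H ((`) \<sigma> ` G). (`) \<rho> ` (`) \<sigma> ` G = (`) \<sigma> ` G"
    using assms(2)[unfolded unique_copies_def mem_Collect_eq] by (rule conjunct2)
  ultimately have "(`) (\<tau> \<circ> inv \<sigma>) ` (`) \<sigma> ` G = (`) \<sigma> ` G" by (rule bspec[rotated])
  then have "(`) \<tau> ` G = (`) \<sigma> ` G" unfolding eq .
  then show ?thesis by (simp only: image_image_comp image_image_inv[OF assms(1)])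
qed

text \<open>The left-hand side counts pairs of a permutation and a labelled graph that it maps into
  \<^term>\<open>unique_copies V H\<close>; graphs with trivial automorphism group account for the first summand on the right,
  and for the others the number of automorphisms is at most twice that of nontrivial ones.\<close>

lemma fact_mult_card_unique_copies:
  assumes "finite V" "H \<subseteq> all_pairs V"
  shows "fact (card V) * card (unique_copies V H) \<le> card (uniquely_embedded V H)
    + 2 * (\<Sum>\<sigma> | \<sigma> permutes V \<and> \<sigma> \<noteq> id. card {G \<in> Pow (all_pairs V). (`) \<sigma> ` G = G})"
proof -
  define S where "S = {\<sigma>. \<sigma> permutes V}"
  define \<G> where "\<G> = Pow (all_pairs V)"
  define W where "W = unique_copies V H"
  define Aut where "Aut G = {\<sigma> \<in> S. (`) \<sigma> ` G = G}" for G
  define B where "B = {G \<in> \<G>. Aut G \<noteq> {id}}"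
  define R where "R G = {\<sigma> \<in> S. (`) \<sigma> ` G \<in> W}" for G
  have finS: "finite S" unfolding S_def by (rule finite_permutations[OF assms(1)])
  have fin\<G>: "finite \<G>" using finite_all_pairs[OF assms(1)] by (simp add: \<G>_def)
  have finR: "finite (R G)" "finite (Aut G)" for G using finS by (auto simp: R_def Aut_def)
  have id: "id \<in> Aut G" for G by (simp add: Aut_def S_def permutes_id)
  have W: "E \<subseteq> all_pairs V" "E \<subseteq> H" if "E \<in> W" for E using that assms(2) by (auto simp: W_def unique_copies_def)
  have aut: "inv \<sigma> \<circ> \<tau> \<in> Aut G" if "\<sigma> \<in> R G" "\<tau> \<in> embeddings V H G" for \<sigma> \<tau> G
    using unique_copies_embedding_automorphism[of \<sigma> V G H \<tau>] that
    by (simp add: R_def Aut_def S_def W_def embeddings_def permutes_compose permutes_inv)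
  have Remb: "\<sigma> \<in> embeddings V H G" if "\<sigma> \<in> R G" for \<sigma> G
    using that W(2) by (simp add: R_def S_def embeddings_def)
  have cancel: "\<tau> = \<tau>'" if "\<sigma> \<in> S" "inv \<sigma> \<circ> \<tau> = inv \<sigma> \<circ> \<tau>'" for \<sigma> \<tau> \<tau>'
  proof -
    have "\<sigma> \<circ> (inv \<sigma> \<circ> \<tau>) = \<sigma> \<circ> (inv \<sigma> \<circ> \<tau>')" using that(2) by simp
    then show ?thesis using that(1) permutes_inv_o(1)[of \<sigma> V] by (simp add: S_def flip: comp_assoc)
  qed
  have "fact (card V) * card W = card (S \<times> W)"
    by (simp add: S_def card_cartesian_product card_permutations[OF refl assms(1)])
  \<comment> \<open>A pair of a permutation and a unique copy is reindexed by the labelled graph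
    that the permutation maps to the copy.\<close>
  also have "\<dots> \<le> card (SIGMA G:\<G>. R G)"
  proof (rule card_inj_on_le)
    show "inj_on (\<lambda>(\<sigma>, E). ((`) (inv \<sigma>) ` E, \<sigma>)) (S \<times> W)"
    proof (rule inj_onI)
      fix x y assume *: "x \<in> S \<times> W" "(\<lambda>(\<sigma>, E). ((`) (inv \<sigma>) ` E, \<sigma>)) x = (\<lambda>(\<sigma>, E). ((`) (inv \<sigma>) ` E, \<sigma>)) y"
      obtain \<sigma> E where x: "x = (\<sigma>, E)" by (cases x)
      obtain E' where y: "y = (\<sigma>, E')" using * x by (cases y) auto
      have "(`) (inv \<sigma>) ` E = (`) (inv \<sigma>) ` E'" "\<sigma> permutes V" using * x y by (auto simp: S_def)
      then have "E = E'" using image_image_inv(2) by metis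
      then show "x = y" using x y by simp
    qed
    show "(\<lambda>(\<sigma>, E). ((`) (inv \<sigma>) ` E, \<sigma>)) ` (S \<times> W) \<subseteq> (SIGMA G:\<G>. R G)"
    proof clarify
      fix \<sigma> E assume *: "\<sigma> \<in> S" "E \<in> W"
      then have \<sigma>: "\<sigma> permutes V" by (simp add: S_def)
      have "(`) (inv \<sigma>) ` E \<in> \<G>"
        using image_all_pairs_subset[OF permutes_inv[OF \<sigma>] W(1)[OF *(2)]] by (simp add: \<G>_def)
      moreover have "\<sigma> \<in> R ((`) (inv \<sigma>) ` E)"
        using * by (simp add: R_def image_image_inv(2)[OF \<sigma>])
      ultimately show "(`) (inv \<sigma>) ` E \<in> \<G> \<and> \<sigma> \<in> R ((`) (inv \<sigma>) ` E)" by blast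
    qed
  qed (use fin\<G> finR in auto)
  also have "\<dots> = card ((SIGMA G:\<G> - B. R G) \<union> (SIGMA G:B. R G))"
    by (rule arg_cong[where f = card]) (auto simp: B_def)
  also have "\<dots> \<le> card (SIGMA G:\<G> - B. R G) + card (SIGMA G:B. R G)" by (rule card_Un_le)
  also have "card (SIGMA G:\<G> - B. R G) \<le> card (uniquely_embedded V H)"
  proof (rule card_inj_on_le)
    have unique: "\<tau> = \<sigma>" if "G \<in> \<G> - B" "\<sigma> \<in> R G" "\<tau> \<in> embeddings V H G" for G \<sigma> \<tau>
    proof -
      have "Aut G = {id}" using that(1) by (simp add: B_def)
      then have "inv \<sigma> \<circ> \<tau> = id" "inv \<sigma> \<circ> \<sigma> = id"
        using aut[OF that(2,3)] aut[OF that(2) Remb[OF that(2)]] by simp_all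
      then show ?thesis using cancel[of \<sigma> \<tau> \<sigma>] that(2) by (simp add: R_def)
    qed
    show "inj_on fst (SIGMA G:\<G> - B. R G)"
    proof (rule inj_onI)
      fix x y assume *: "x \<in> (SIGMA G:\<G> - B. R G)" "y \<in> (SIGMA G:\<G> - B. R G)" "fst x = fst y"
      then have "snd y = snd x" using unique[of "fst x" "snd x" "snd y"] Remb[of "snd y" "fst x"] by auto
      then show "x = y" using *(3) by (simp add: prod_eq_iff)
    qed
    show "fst ` (SIGMA G:\<G> - B. R G) \<subseteq> uniquely_embedded V H"
    proof (rule image_subsetI)
      fix x assume x: "x \<in> (SIGMA G:\<G> - B. R G)"
      then have "\<exists>!\<sigma>. \<sigma> \<in> embeddings V H (fst x)"
        by (intro ex1I[of _ "snd x"]) (auto intro: unique Remb)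
      then show "fst x \<in> uniquely_embedded V H"
        using x by (auto simp: uniquely_embedded_def \<G>_def)
    qed
    show "finite (uniquely_embedded V H)"
      using fin\<G> by (simp add: uniquely_embedded_def \<G>_def)
  qed
  also have "card (SIGMA G:B. R G) = (\<Sum>G\<in>B. card (R G))"
    using fin\<G> finR by (subst card_SigmaI) (auto simp: B_def)
  \<comment> \<open>\<open>R G\<close> injects into \<open>Aut G\<close> by the coset argument, and
    a group of order \<open>k \<ge> 2\<close> satisfies \<open>k \<le> 2 * (k - 1)\<close>.\<close>
  also have "\<dots> \<le> (\<Sum>G\<in>B. 2 * card (Aut G - {id}))"
  proof (rule sum_mono)
    fix G assume G: "G \<in> B"
    then have "Aut G - {id} \<noteq> {}" using id[of G] by (auto simp: B_def)
    then have ne: "card (Aut G - {id}) \<noteq> 0" using finR by (simp only: card_eq_0_iff) simp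
    have "card (R G) \<le> card (Aut G)"
    proof (cases "R G = {}")
      case False
      then obtain \<sigma> where \<sigma>: "\<sigma> \<in> R G" by blast
      show ?thesis
      proof (rule card_inj_on_le[of "\<lambda>\<tau>. inv \<sigma> \<circ> \<tau>"])
        show "inj_on (\<lambda>\<tau>. inv \<sigma> \<circ> \<tau>) (R G)"
          using cancel[of \<sigma>] \<sigma> by (intro inj_onI) (simp add: R_def)
        show "(\<lambda>\<tau>. inv \<sigma> \<circ> \<tau>) ` R G \<subseteq> Aut G"
          using aut[OF \<sigma>] Remb by blast
      qed (rule finR)
    qed simp
    also have "card (Aut G) = Suc (card (Aut G - {id}))"
      using id finR by (metis card_Suc_Diff1)
    also have "\<dots> \<le> 2 * card (Aut G - {id})" using ne by simp
    finally show "card (R G) \<le> 2 * card (Aut G - {id})" .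
  qed
  also have "\<dots> \<le> (\<Sum>G\<in>\<G>. 2 * card (Aut G - {id}))"
    using fin\<G> by (intro sum_mono2) (auto simp: B_def)
  also have "\<dots> = 2 * card (SIGMA G:\<G>. Aut G - {id})"
    using fin\<G> finR by (subst card_SigmaI) (auto simp: sum_distrib_left)
  \<comment> \<open>Double counting as in Burnside's lemma.\<close>
  also have "card (SIGMA G:\<G>. Aut G - {id}) = card (SIGMA \<sigma>:S - {id}. {G \<in> \<G>. (`) \<sigma> ` G = G})"
    by (rule bij_betw_same_card[of prod.swap], rule bij_betw_byWitness[where f' = prod.swap])
      (auto simp: Aut_def)
  also have "\<dots> = (\<Sum>\<sigma>\<in>S - {id}. card {G \<in> \<G>. (`) \<sigma> ` G = G})"
    using fin\<G> finS by (subst card_SigmaI) auto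
  also have "S - {id} = {\<sigma>. \<sigma> permutes V \<and> \<sigma> \<noteq> id}" by (auto simp: S_def)
  finally show ?thesis by (simp add: W_def \<G>_def)
qed

text \<open>Every edge in the preimage of the complement of \<open>H\<close> under the unique embedding is pivotal for
  the existence of an embedding, and a monotone property has few pivotal edges on average.\<close>

lemma card_uniquely_embedded_mult_complement:
  assumes "finite V" "H \<subseteq> all_pairs V"
  defines "P \<equiv> all_pairs V"
  shows "real (card (uniquely_embedded V H)) * card (P - H) \<le> sqrt (card P) * 2 ^ card P"
proof -
  define \<D> where "\<D> = {G \<in> Pow P. embeddings V H G \<noteq> {}}"
  have finP: "finite P" using finite_all_pairs[OF assms(1)] by (simp add: P_def)
  have sub: "uniquely_embedded V H \<subseteq> \<D>" by (auto simp: \<D>_def uniquely_embedded_def P_def)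
  have fin\<D>: "finite \<D>" using finP by (simp add: \<D>_def)
  have pivotal: "card (P - H) \<le> card {x \<in> P - G. insert x G \<notin> \<D>}" if G: "G \<in> uniquely_embedded V H" for G
  proof -
    obtain \<sigma> where \<sigma>: "\<sigma> \<in> embeddings V H G" and uniq: "\<And>\<tau>. \<tau> \<in> embeddings V H G \<Longrightarrow> \<tau> = \<sigma>"
      using G unfolding uniquely_embedded_def by blast
    have perm: "\<sigma> permutes V" and GH: "(`) \<sigma> ` G \<subseteq> H" using \<sigma> by (auto simp: embeddings_def)
    have cancel: "\<sigma> ` inv \<sigma> ` y = y" for y
      using permutes_inv_o(1)[OF perm] by (simp add: image_comp)
    show ?thesis
    proof (rule card_inj_on_le)
      show "inj_on ((`) (inv \<sigma>)) (P - H)" using cancel by (metis inj_onI)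
      show "(`) (inv \<sigma>) ` (P - H) \<subseteq> {x \<in> P - G. insert x G \<notin> \<D>}"
      proof (rule image_subsetI)
        fix y assume y: "y \<in> P - H"
        have "inv \<sigma> ` y \<in> P"
          using y image_all_pairs_subset[OF permutes_inv[OF perm], of "{y}"] by (simp add: P_def)
        moreover have "inv \<sigma> ` y \<notin> G" using GH y cancel[of y] by (metis DiffD2 imageI subsetD)
        \<comment> \<open>An embedding of the enlarged graph also embeds \<open>G\<close>, so it is
          \<open>\<sigma>\<close>; but \<open>\<sigma>\<close> maps the new edge to
          \<open>y\<close>, outside \<open>H\<close>.\<close>
        moreover have "insert (inv \<sigma> ` y) G \<notin> \<D>"
        proof
          assume "insert (inv \<sigma> ` y) G \<in> \<D>"
          then obtain \<tau> where \<tau>: "\<tau> \<in> embeddings V H (insert (inv \<sigma> ` y) G)" by (auto simp: \<D>_def)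
          then have "\<tau> \<in> embeddings V H G" by (auto simp: embeddings_def)
          then have "\<tau> = \<sigma>" by (rule uniq)
          then show False using \<tau> y cancel[of y] by (simp add: embeddings_def)
        qed
        ultimately show "inv \<sigma> ` y \<in> {x \<in> P - G. insert x G \<notin> \<D>}" by blast
      qed
    qed (use finP in auto)
  qed
  have "card (uniquely_embedded V H) * card (P - H) = (\<Sum>G\<in>uniquely_embedded V H. card (P - H))" by simp
  also have "\<dots> \<le> (\<Sum>G\<in>uniquely_embedded V H. card {x \<in> P - G. insert x G \<notin> \<D>})"
    by (intro sum_mono pivotal)
  also have "\<dots> \<le> (\<Sum>G\<in>\<D>. card {x \<in> P - G. insert x G \<notin> \<D>})"
    using sub fin\<D> by (intro sum_mono2) auto
  finally have "real (card (uniquely_embedded V H) * card (P - H))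
      \<le> real (\<Sum>G\<in>\<D>. card {x \<in> P - G. insert x G \<notin> \<D>})" by (simp only: of_nat_le_iff)
  also have "\<dots> \<le> sqrt (card P) * 2 ^ card P"
    using finP by (intro downset_edge_boundary) (auto simp: \<D>_def embeddings_def)
  finally show ?thesis by simp
qed

section \<open>Sparse complements\<close>

definition nbhd :: "'a set set \<Rightarrow> 'a \<Rightarrow> 'a set" where
  "nbhd F v = {w. {v, w} \<in> F}"

lemma nbhd_all_pairs:
  assumes "F \<subseteq> all_pairs V" "w \<in> nbhd F v"
  shows "v \<in> V" "w \<in> V" "v \<noteq> w"
proof -
  have "{v, w} \<in> all_pairs V" using assms by (auto simp: nbhd_def)
  then show "v \<in> V" "w \<in> V" "v \<noteq> w" by (auto simp: all_pairs_def)
qed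

lemma finite_nbhd:
  assumes "finite V" "F \<subseteq> all_pairs V"
  shows "finite (nbhd F v)"
  using assms(1) by (rule finite_subset[rotated]) (use nbhd_all_pairs[OF assms(2)] in blast)

lemma sum_card_nbhd:
  assumes "finite V" "F \<subseteq> all_pairs V"
  shows "(\<Sum>v\<in>V. card (nbhd F v)) = 2 * card F"
proof -
  have finF: "finite F" using assms finite_all_pairs finite_subset by metis
  have e: "finite e" "card e = 2" "e \<subseteq> V" if "e \<in> F" for e
    using that assms finite_subset[OF _ assms(1)] by (auto simp: all_pairs_def)
  have "(\<Sum>v\<in>V. card (nbhd F v)) = card (SIGMA v:V. nbhd F v)"
    using assms finite_nbhd by (subst card_SigmaI) auto
  also have "\<dots> = card (SIGMA e:F. e)"
  proof (rule bij_betw_same_card)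
    show "bij_betw (\<lambda>(v, w). ({v, w}, v)) (SIGMA v:V. nbhd F v) (SIGMA e:F. e)"
    proof (rule bij_betw_imageI)
      show "inj_on (\<lambda>(v, w). ({v, w}, v)) (SIGMA v:V. nbhd F v)"
        by (auto simp: inj_on_def doubleton_eq_iff)
      show "(\<lambda>(v, w). ({v, w}, v)) ` (SIGMA v:V. nbhd F v) = (SIGMA e:F. e)"
      proof (intro equalityI subsetI)
        fix x assume "x \<in> (SIGMA e:F. e)"
        then obtain e v where x: "x = (e, v)" "e \<in> F" "v \<in> e" by blast
        then obtain w where "e = {v, w}"
          using e(2)[OF x(2)] by (auto simp: card_2_iff)
        then show "x \<in> (\<lambda>(v, w). ({v, w}, v)) ` (SIGMA v:V. nbhd F v)"
          using x e(3)[OF x(2)] by (intro image_eqI[of _ _ "(v, w)"]) (auto simp: nbhd_def)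
      qed (auto simp: nbhd_def)
    qed
  qed
  also have "\<dots> = 2 * card F"
    using finF e by (subst card_SigmaI) auto
  finally show ?thesis .
qed

text \<open>Markov's inequality: the degrees sum to at most \<open>2 * K * card V\<close>, so at
  most half of the vertices exceed twice that average.\<close>

lemma many_low_degree_vertices:
  assumes "finite V" "F \<subseteq> all_pairs V" "card F \<le> K * card V"
  shows "card V \<le> 2 * card {v \<in> V. card (nbhd F v) \<le> 4 * K}"
proof -
  let ?B = "{v \<in> V. \<not> card (nbhd F v) \<le> 4 * K}"
  have "card ?B * (4 * K + 1) \<le> (\<Sum>v\<in>?B. card (nbhd F v))"
    by (subst mult.commute, rule order_trans[OF _ sum_mono[of ?B "\<lambda>_. 4 * K + 1"]]) (auto simp: algebra_simps)
  also have "\<dots> \<le> (\<Sum>v\<in>V. card (nbhd F v))" using assms(1) by (intro sum_mono2) auto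
  also have "\<dots> \<le> 2 * (K * card V)" using sum_card_nbhd[OF assms(1,2)] assms(3) by simp
  finally have "card ?B * (4 * K + 1) * 2 \<le> card V * (4 * K)" by (simp add: algebra_simps)
  also have "\<dots> \<le> card V * (4 * K + 1)" by simp
  finally have "(2 * card ?B) * (4 * K + 1) \<le> card V * (4 * K + 1)" by (simp only: mult.commute mult.left_commute)
  then have "2 * card ?B \<le> card V" by (subst (asm) mult_le_cancel2) simp
  moreover have "card V = card {v \<in> V. card (nbhd F v) \<le> 4 * K} + card ?B"
    using assms(1) by (subst card_Un_disjoint[symmetric]) (auto intro: arg_cong[where f = card])
  ultimately show ?thesis by simp
qed

definition independent_vertices :: "'a set set \<Rightarrow> 'a set \<Rightarrow> bool" where
  "independent_vertices F L \<longleftrightarrow> (\<forall>v\<in>L. nbhd F v \<inter> L = {})"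

text \<open>A maximal independent subset dominates \<open>A\<close>: every vertex of
  \<open>A\<close> lies in it or is adjacent to it.\<close>

lemma independent_subset_exists:
  assumes "finite V" "F \<subseteq> all_pairs V" "A \<subseteq> V" "\<And>v. v \<in> A \<Longrightarrow> card (nbhd F v) \<le> d"
  shows "\<exists>L\<subseteq>A. independent_vertices F L \<and> card A \<le> (d + 1) * card L"
proof -
  define \<L> where "\<L> = {L. L \<subseteq> A \<and> independent_vertices F L}"
  have finA: "finite A" using assms finite_subset by metis
  then have "finite \<L>" by (simp add: \<L>_def)
  moreover have "{} \<in> \<L>" by (simp add: \<L>_def independent_vertices_def)
  ultimately obtain L where L: "L \<in> \<L>" and max: "\<forall>L'\<in>\<L>. L \<subseteq> L' \<longrightarrow> L = L'"
    by (metis finite_has_maximal empty_iff)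
  have LA: "L \<subseteq> A" and ind: "independent_vertices F L" using L by (auto simp: \<L>_def)
  have finL: "finite L" by (rule finite_subset[OF LA finA])
  have sym: "w \<in> nbhd F v \<longleftrightarrow> v \<in> nbhd F w" for v w by (simp add: nbhd_def insert_commute)
  have "A \<subseteq> L \<union> (\<Union>v\<in>L. nbhd F v)"
  proof (rule ccontr)
    assume "\<not> ?thesis"
    then obtain w where w: "w \<in> A" "w \<notin> L" "\<And>v. v \<in> L \<Longrightarrow> w \<notin> nbhd F v" by blast
    have "w \<notin> nbhd F w" using nbhd_all_pairs(3)[OF assms(2)] by blast
    then have "independent_vertices F (insert w L)"
      using ind w(3) sym unfolding independent_vertices_def by blast
    then have "insert w L \<in> \<L>" using w(1) LA by (simp add: \<L>_def)
    then show False using max w(2) by blast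
  qed
  then have "card A \<le> card (L \<union> (\<Union>v\<in>L. nbhd F v))"
    using finL finite_nbhd[OF assms(1,2)] by (intro card_mono) auto
  also have "\<dots> \<le> card L + card (\<Union>v\<in>L. nbhd F v)" by (rule card_Un_le)
  also have "card (\<Union>v\<in>L. nbhd F v) \<le> (\<Sum>v\<in>L. card (nbhd F v))" by (rule card_UN_le[OF finL])
  also have "\<dots> \<le> (\<Sum>v\<in>L. d)" using assms(4) LA by (intro sum_mono) blast
  finally have "card A \<le> (d + 1) * card L" by (simp add: mult.commute)
  then show ?thesis using LA ind by blast
qed

text \<open>\<open>swap_edges F {u, v}\<close> consists of the edges by which the image of \<open>F\<close> under the transposition of \<open>u\<close> and \<open>v\<close>
  exceeds \<open>F\<close>.\<close>

definition swap_edges :: "'a set set \<Rightarrow> 'a set \<Rightarrow> 'a set set" where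
  "swap_edges F e = {x. x \<notin> F \<and> (\<exists>u v w. e = {u, v} \<and> u \<noteq> v \<and> w \<noteq> v \<and> x = {v, w} \<and> w \<in> nbhd F u)}"

lemma swap_edges_subset_all_pairs:
  assumes "F \<subseteq> all_pairs V" "e \<subseteq> V"
  shows "swap_edges F e \<subseteq> all_pairs V"
  using assms(2) nbhd_all_pairs[OF assms(1)] by (fastforce simp: swap_edges_def all_pairs_def)

lemma card_swap_edges:
  assumes "finite V" "F \<subseteq> all_pairs V" "card e = 2" "\<And>v. v \<in> e \<Longrightarrow> card (nbhd F v) \<le> d"
  shows "card (swap_edges F e) \<le> 2 * d"
proof -
  obtain u v where e: "e = {u, v}" using assms(3) by (auto simp: card_2_iff)
  let ?U = "(\<lambda>w. {v, w}) ` nbhd F u" and ?V = "(\<lambda>w. {u, w}) ` nbhd F v"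
  have fin: "finite (nbhd F a)" for a by (rule finite_nbhd[OF assms(1,2)])
  have "card (swap_edges F e) \<le> card (?U \<union> ?V)"
    using fin by (intro card_mono) (auto simp: swap_edges_def e doubleton_eq_iff)
  also have "\<dots> \<le> card ?U + card ?V" by (rule card_Un_le)
  also have "\<dots> \<le> card (nbhd F u) + card (nbhd F v)" by (intro add_mono card_image_le fin)
  also have "\<dots> \<le> 2 * d" using assms(4)[of u] assms(4)[of v] e by simp
  finally show ?thesis .
qed

text \<open>A pair containing both or neither of \<open>u\<close> and \<open>v\<close> is fixed by
  the transposition and would stay in \<open>F\<close>. Any other pair has exactly one endpoint
  exchanged, which is the form of the members of \<open>swap_edges\<close>.\<close>

lemma transpose_image_mem_swap_edges:
  assumes "F \<subseteq> all_pairs V" "u \<noteq> v" "f \<in> F" "transpose u v ` f \<notin> F"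
  shows "transpose u v ` f \<in> swap_edges F {u, v}"
proof -
  obtain a b where f: "f = {a, b}" "a \<noteq> b"
    using assms(1,3) by (auto simp: all_pairs_def card_2_iff)
  have nb: "b \<in> nbhd F a" "a \<in> nbhd F b" using assms(3) f by (auto simp: nbhd_def insert_commute)
  have f': "transpose u v ` f = {transpose u v a, transpose u v b}" using f by simp
  have "\<exists>u' v' w. {u, v} = {u', v'} \<and> u' \<noteq> v' \<and> w \<noteq> v' \<and> transpose u v ` f = {v', w} \<and> w \<in> nbhd F u'"
  proof -
    consider "{a, b} = {u, v}" | "a = u" "b \<noteq> v" | "a = v" "b \<noteq> u" | "b = u" "a \<noteq> v" | "b = v" "a \<noteq> u"
      | "a \<notin> {u, v}" "b \<notin> {u, v}" by blast
    then show ?thesis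
    proof cases
      case 1
      then have "transpose u v ` f = f" using f by (auto simp: transpose_def doubleton_eq_iff)
      then show ?thesis using assms(3,4) by simp
    next
      case 2
      then have "transpose u v a = v" "transpose u v b = b" using f(2) assms(2) by (auto simp: transpose_def)
      then have "transpose u v ` f = {v, b}" unfolding f' by (simp)
      then show ?thesis using 2 nb assms(2) by blast
    next
      case 3
      then have "transpose u v a = u" "transpose u v b = b" using f(2) assms(2) by (auto simp: transpose_def)
      then have "transpose u v ` f = {u, b}" unfolding f' by (simp)
      then show ?thesis using 3 nb assms(2) by (metis insert_commute)
    next
      case 4
      then have "transpose u v a = a" "transpose u v b = v" using f(2) assms(2) by (auto simp: transpose_def)
      then have "transpose u v ` f = {v, a}" unfolding f' by (simp add: insert_commute)
      then show ?thesis using 4 nb assms(2) by blast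
    next
      case 5
      then have "transpose u v a = a" "transpose u v b = u" using f(2) assms(2) by (auto simp: transpose_def)
      then have "transpose u v ` f = {u, a}" unfolding f' by (simp add: insert_commute)
      then show ?thesis using 5 nb assms(2) by (metis insert_commute)
    next
      case 6
      then have "transpose u v ` f = f" using f by (simp add: transpose_def)
      then show ?thesis using assms(3,4) by simp
    qed
  qed
  then show ?thesis using assms(4) unfolding swap_edges_def by blast
qed

text \<open>An edge \<open>{v, w}\<close> of \<open>swap_edges F {u, v}\<close> meets \<open>L\<close> only in \<open>v\<close>, which determines the sunflower, and \<open>w\<close> lies outside its
  kernel, so that it determines \<open>u\<close>.\<close>

lemma disjoint_swap_edges:
  assumes "independent_vertices F L" "disjoint \<S>" "\<And>S. S \<in> \<S> \<Longrightarrow> S \<subseteq> L \<and> sunflower (nbhd F) S"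
  shows "disjoint_family_on (swap_edges F) (\<Union>S\<in>\<S>. all_pairs S)"
proof (unfold disjoint_family_on_def, intro ballI impI)
  fix e e' assume "e \<in> (\<Union>S\<in>\<S>. all_pairs S)" "e' \<in> (\<Union>S\<in>\<S>. all_pairs S)" and ne: "e \<noteq> e'"
  then obtain S S' where S: "S \<in> \<S>" "e \<subseteq> S" and S': "S' \<in> \<S>" "e' \<subseteq> S'"
    by (auto simp: all_pairs_def)
  show "swap_edges F e \<inter> swap_edges F e' = {}"
  proof (rule ccontr)
    assume "\<not> ?thesis"
    then obtain x where x: "x \<in> swap_edges F e" "x \<in> swap_edges F e'" by blast
    then obtain u v w where e: "e = {u, v}" "u \<noteq> v" "x = {v, w}" "w \<in> nbhd F u" and xF: "x \<notin> F"
      by (auto simp: swap_edges_def)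
    obtain u' v' w' where e': "e' = {u', v'}" "u' \<noteq> v'" "x = {v', w'}" "w' \<in> nbhd F u'"
      using x(2) by (auto simp: swap_edges_def)
    have L: "u \<in> L" "v \<in> L" "u' \<in> L" "v' \<in> L"
      using S S' e(1) e'(1) assms(3) by blast+
    have "w \<notin> L" "w' \<notin> L" using assms(1) L e(4) e'(4) unfolding independent_vertices_def by blast+
    then have eq: "v = v'" "w = w'" using e(3) e'(3) L by (auto simp: doubleton_eq_iff)
    then have "S = S'" using S S' e(1) e'(1) assms(2) unfolding disjoint_def by blast
    obtain Y where Y: "\<forall>i\<in>S. \<forall>j\<in>S. i \<noteq> j \<longrightarrow> nbhd F i \<inter> nbhd F j = Y"
      using assms(3)[OF S(1)] unfolding sunflower_def by blast
    have "u \<noteq> u'" using ne e(1) e'(1) eq by blast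
    moreover have "u \<in> S" "v \<in> S" "u' \<in> S" using S S' e(1) e'(1) \<open>S = S'\<close> by blast+
    \<comment> \<open>The common neighbour \<open>w\<close> of \<open>u\<close> and
      \<open>u'\<close> lies in the kernel, hence is adjacent to \<open>v\<close> as well, although
      \<open>x = {v, w}\<close> is not in \<open>F\<close>.\<close>
    ultimately have "nbhd F u \<inter> nbhd F u' = nbhd F u \<inter> nbhd F v" using Y e(2) by simp
    then have "w \<in> nbhd F v" using e(4) e'(4) eq(2) by blast
    then show False using xF e(3) by (simp add: nbhd_def)
  qed
qed

lemma card_pairs_in_disjoint_sets:
  assumes "finite \<S>" "disjoint \<S>" "\<And>S. S \<in> \<S> \<Longrightarrow> finite S \<and> card S = p"
  shows "card (\<Union>S\<in>\<S>. all_pairs S) = card \<S> * (p choose 2)"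
proof -
  have "card (\<Union>S\<in>\<S>. all_pairs S) = (\<Sum>S\<in>\<S>. card (all_pairs S))"
  proof (rule card_UN_disjoint)
    show "\<forall>S\<in>\<S>. \<forall>T\<in>\<S>. S \<noteq> T \<longrightarrow> all_pairs S \<inter> all_pairs T = {}"
    proof (intro ballI impI equals0I)
      fix S T e assume *: "S \<in> \<S>" "T \<in> \<S>" "S \<noteq> T" and e: "e \<in> all_pairs S \<inter> all_pairs T"
      have "S \<inter> T = {}" using assms(2) * by (simp add: disjoint_def)
      moreover have "e \<subseteq> S \<inter> T" "card e = 2" using e by (simp_all add: all_pairs_def)
      ultimately show False by auto
    qed
  qed (use assms finite_all_pairs in auto)
  also have "\<dots> = (\<Sum>S\<in>\<S>. p choose 2)" by (intro sum.cong) (use assms card_all_pairs in auto)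
  finally show ?thesis by simp
qed

text \<open>A unique embedding composed with a transposition must fail to be an embedding, so the copy of \<open>G\<close> hits all the sets
  \<^const>\<open>swap_edges\<close>; the factor \<open>fact (card V)\<close> is a union bound over the embedding.\<close>

lemma card_uniquely_embedded_swap_edges:
  assumes "finite V" "H \<subseteq> all_pairs V"
    and F: "F = all_pairs V - H" and P: "P = all_pairs V"
    and "I \<subseteq> P"
  shows "card (uniquely_embedded V H) \<le> fact (card V) * card {G \<in> Pow P. \<forall>e\<in>I. G \<inter> swap_edges F e \<noteq> {}}"
proof -
  let ?Z = "{G \<in> Pow P. \<forall>e\<in>I. G \<inter> swap_edges F e \<noteq> {}}"
  let ?S = "{\<sigma>. \<sigma> permutes V}"
  have finP: "finite P" using P finite_all_pairs[OF assms(1)] by simp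
  have hit: "(`) \<sigma> ` G \<in> ?Z" if "G \<in> uniquely_embedded V H" "\<sigma> \<in> embeddings V H G" for \<sigma> G
  proof -
    have \<sigma>: "\<sigma> permutes V" "(`) \<sigma> ` G \<subseteq> H" using that(2) by (auto simp: embeddings_def)
    have "(`) \<sigma> ` G \<inter> swap_edges F e \<noteq> {}" if e: "e \<in> I" for e
    proof -
      obtain u v where uv: "e = {u, v}" "u \<noteq> v" "u \<in> V" "v \<in> V"
        using e assms(5) P by (auto simp: all_pairs_def card_2_iff)
      let ?t = "transpose u v"
      have t: "?t permutes V" using uv by (simp add: permutes_swap_id)
      have "?t \<circ> \<sigma> \<noteq> \<sigma>"
      proof
        assume "?t \<circ> \<sigma> = \<sigma>"
        then have "?t (\<sigma> (inv \<sigma> u)) = \<sigma> (inv \<sigma> u)" by (metis comp_apply)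
        then show False using uv(2) permutes_inverses(1)[OF \<sigma>(1)] by (simp add: transpose_def)
      qed
      then have "?t \<circ> \<sigma> \<notin> embeddings V H G"
        using \<open>G \<in> uniquely_embedded V H\<close> \<open>\<sigma> \<in> embeddings V H G\<close> unfolding uniquely_embedded_def by blast
      then have "\<not> (`) ?t ` (`) \<sigma> ` G \<subseteq> H"
        using permutes_compose[OF \<sigma>(1) t] by (simp only: embeddings_def mem_Collect_eq image_image_comp) blast
      \<comment> \<open>The edge \<open>x\<close> of the copy is sent into \<open>F\<close> by the
        transposition. As this is an involution, \<open>x\<close> is itself the image of an edge of
        \<open>F\<close>, and it is not in \<open>F\<close>.\<close>
      then obtain x where x: "x \<in> (`) \<sigma> ` G" "?t ` x \<notin> H" by blast
      have xH: "x \<in> H" using x(1) \<sigma>(2) by blast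
      have "?t ` x \<in> all_pairs V" using image_all_pairs_subset[OF t, of "{x}"] xH assms(2) by blast
      then have "?t ` x \<in> F" using x(2) F by blast
      moreover have tt: "?t ` ?t ` x = x" by (simp add: image_image)
      moreover have "x \<notin> F" using xH F by blast
      ultimately have "x \<in> swap_edges F e"
        using transpose_image_mem_swap_edges[of F V u v "?t ` x"] uv F by auto
      then show ?thesis using x(1) by blast
    qed
    moreover have "(`) \<sigma> ` G \<in> Pow P" using \<sigma>(2) assms(2) P by blast
    ultimately show ?thesis by blast
  qed
  have "card (uniquely_embedded V H) \<le> card (?S \<times> ?Z)"
  proof (rule card_inj_on_le)
    \<comment> \<open>A labelled graph is recovered from its embedding together with its
      copy.\<close>
    define s where "s G = (THE \<sigma>. \<sigma> \<in> embeddings V H G)" for G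
    have s: "s G \<in> embeddings V H G" if "G \<in> uniquely_embedded V H" for G
      using that theI'[of "\<lambda>\<sigma>. \<sigma> \<in> embeddings V H G"] by (simp add: uniquely_embedded_def s_def)
    show "inj_on (\<lambda>G. (s G, (`) (s G) ` G)) (uniquely_embedded V H)"
    proof (rule inj_onI)
      fix G G' assume G: "G \<in> uniquely_embedded V H"
        and eq: "(s G, (`) (s G) ` G) = (s G', (`) (s G') ` G')"
      then have *: "s G = s G'" "(`) (s G) ` G = (`) (s G') ` G'" by blast+
      have "(`) (s G) ` G = (`) (s G) ` G'" using *(2) unfolding *(1)[symmetric] .
      moreover have "s G permutes V" using s[OF G] by (simp add: embeddings_def)
      ultimately show "G = G'" using image_image_inv(1) by metis
    qed
    show "(\<lambda>G. (s G, (`) (s G) ` G)) ` uniquely_embedded V H \<subseteq> ?S \<times> ?Z"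
    proof (rule image_subsetI, rule SigmaI)
      fix G assume G: "G \<in> uniquely_embedded V H"
      show "s G \<in> ?S" using s[OF G] by (simp add: embeddings_def)
      show "(`) (s G) ` G \<in> ?Z" by (rule hit[OF G s[OF G]])
    qed
  qed (use finP finite_permutations[OF assms(1)] in auto)
  also have "\<dots> = fact (card V) * card ?Z"
    by (simp add: card_cartesian_product card_permutations[OF refl assms(1)])
  finally show ?thesis .
qed

text \<open>Half of the vertices have degree at most \<open>d\<close>, and a fraction
  \<open>1 / (d + 1)\<close> of those is independent. Splitting them into sunflowers with
  \<open>p\<close> petals yields at least \<open>card V * (p - 1) / (8 * (d + 1))\<close> pairs with
  disjoint swap sets, each of size at most \<open>2 * d\<close>.\<close>

lemma card_uniquely_embedded_sparse_complement:
  fixes p K :: nat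
  assumes "finite V" "H \<subseteq> all_pairs V" "card (all_pairs V - H) \<le> K * card V"
    and d: "d = 4 * K" and "K \<ge> 1" "p \<ge> 1" "4 * (d + 1) * (p * (d + 1)) ^ (d + 1) \<le> card V"
  shows "real (card (uniquely_embedded V H)) \<le> fact (card V) * (2 ^ card (all_pairs V)
    * (1 - 1 / 2 ^ (2 * d)) powr (real (card V * (p - 1)) / real (8 * (d + 1))))"
proof -
  define F where "F = all_pairs V - H"
  define c where "c = (p * (d + 1)) ^ (d + 1)"
  define A where "A = {v \<in> V. card (nbhd F v) \<le> d}"
  have FP: "F \<subseteq> all_pairs V" by (auto simp: F_def)
  have A: "card V \<le> 2 * card A"
    using many_low_degree_vertices[OF assms(1) FP] assms(3) by (simp add: A_def F_def d)
  obtain L where L: "L \<subseteq> A" "independent_vertices F L" "card A \<le> (d + 1) * card L"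
  proof -
    have "\<exists>L\<subseteq>A. independent_vertices F L \<and> card A \<le> (d + 1) * card L"
      by (rule independent_subset_exists[OF assms(1) FP]) (auto simp: A_def)
    then show ?thesis using that by blast
  qed
  have LV: "L \<subseteq> V" and deg: "\<And>v. v \<in> L \<Longrightarrow> card (nbhd F v) \<le> d" using L(1) by (auto simp: A_def)
  have finL: "finite L" by (rule finite_subset[OF LV assms(1)])
  have "\<exists>\<S>. finite \<S> \<and> disjoint \<S> \<and> (\<forall>S\<in>\<S>. S \<subseteq> L \<and> card S = p \<and> sunflower (nbhd F) S)
      \<and> card L \<le> p * card \<S> + c"
  proof (rule disjoint_subsets_exhaust[OF finL \<open>p \<ge> 1\<close>])
    fix L' assume L': "L' \<subseteq> L" "c \<le> card L'"
    show "\<exists>J\<subseteq>L'. card J = p \<and> sunflower (nbhd F) J"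
    proof (rule sunflower_exists[where d = d])
      show "finite L'" by (rule finite_subset[OF L'(1) finL])
      show "finite (nbhd F v) \<and> card (nbhd F v) \<le> d" if "v \<in> L'" for v
        using finite_nbhd[OF assms(1) FP] deg L'(1) that by blast
    qed (use L'(2) \<open>p \<ge> 1\<close> in \<open>simp_all add: c_def\<close>)
  qed
  then obtain \<S> where \<S>: "finite \<S>" "disjoint \<S>" "\<And>S. S \<in> \<S> \<Longrightarrow> S \<subseteq> L \<and> card S = p \<and> sunflower (nbhd F) S"
    and cL: "card L \<le> p * card \<S> + c" by blast
  define I where "I = (\<Union>S\<in>\<S>. all_pairs S)"
  have IV: "I \<subseteq> all_pairs V" using \<S>(3) LV by (fastforce simp: I_def all_pairs_def)
  have finI: "finite I" by (rule finite_subset[OF IV finite_all_pairs[OF assms(1)]])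
  have eL: "e \<subseteq> L" "card e = 2" if "e \<in> I" for e using that \<S>(3) by (auto simp: I_def all_pairs_def)
  have cI: "card I = card \<S> * (p choose 2)"
    unfolding I_def by (rule card_pairs_in_disjoint_sets[OF \<S>(1,2)]) (use \<S>(3) finL finite_subset in metis)
  have "card V \<le> 2 * ((d + 1) * (p * card \<S> + c))"
    using A L(3) cL by (meson le_trans mult_le_mono2)
  then have "2 * card V \<le> 4 * (d + 1) * (p * card \<S>) + 4 * (d + 1) * c" by (simp add: algebra_simps)
  \<comment> \<open>The size hypothesis says \<open>4 * (d + 1) * c \<le> card V\<close>, so the
    vertices outside the sunflowers cost only a factor 2.\<close>
  then have "card V \<le> 4 * (d + 1) * (p * card \<S>)" using assms(7) unfolding c_def by linarith
  then have "card V * (p - 1) \<le> 4 * (d + 1) * (p * card \<S>) * (p - 1)" by (rule mult_le_mono1)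
  also have "\<dots> = 8 * (d + 1) * card I"
  proof -
    have "p * (p - 1) = 2 * (p choose 2)" by (cases p) (simp_all add: choose_two)
    then have "4 * (d + 1) * card \<S> * (p * (p - 1)) = 4 * (d + 1) * card \<S> * (2 * (p choose 2))" by (rule arg_cong)
    then show ?thesis unfolding cI by (simp add: algebra_simps)
  qed
  finally have "real (card V * (p - 1)) \<le> real (8 * (d + 1) * card I)" by (simp only: of_nat_le_iff)
  then have t: "real (card V * (p - 1)) / real (8 * (d + 1)) \<le> card I" by (simp add: field_simps)
  define q :: real where "q = 1 - 1 / 2 ^ (2 * d)"
  have "1 / 2 ^ (2 * d) < (1 :: real)" using \<open>K \<ge> 1\<close> by (simp add: d one_less_power)
  then have q: "0 < q" "q \<le> 1" by (simp_all add: q_def)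
  have "real (card {G \<in> Pow (all_pairs V). \<forall>e\<in>I. G \<inter> swap_edges F e \<noteq> {}}) \<le> 2 ^ card (all_pairs V) * q ^ card I"
    unfolding q_def
  proof (rule card_sets_hitting_disjoint_family[OF finI finite_all_pairs[OF assms(1)]])
    show "swap_edges F e \<subseteq> all_pairs V" if "e \<in> I" for e
      using eL[OF that] LV by (intro swap_edges_subset_all_pairs[OF FP]) blast
    show "disjoint_family_on (swap_edges F) I"
      unfolding I_def using \<S>(3) by (intro disjoint_swap_edges[OF L(2) \<S>(2)]) blast
    show "card (swap_edges F e) \<le> 2 * d" if "e \<in> I" for e
      using eL[OF that] deg by (intro card_swap_edges[OF assms(1) FP]) blast+
  qed
  also have "q ^ card I \<le> q powr (real (card V * (p - 1)) / real (8 * (d + 1)))"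
  proof -
    have "q ^ card I = q powr (card I)" using q by (simp add: powr_realpow)
    \<comment> \<open>As \<open>q \<le> 1\<close>, lowering the exponent raises the power.\<close>
    also have "\<dots> \<le> q powr (real (card V * (p - 1)) / real (8 * (d + 1)))" using t q by (intro powr_mono') auto
    finally show ?thesis .
  qed
  finally have Z: "real (card {G \<in> Pow (all_pairs V). \<forall>e\<in>I. G \<inter> swap_edges F e \<noteq> {}})
      \<le> 2 ^ card (all_pairs V) * q powr (real (card V * (p - 1)) / real (8 * (d + 1)))" by simp
  have "real (card (uniquely_embedded V H))
      \<le> real (fact (card V) * card {G \<in> Pow (all_pairs V). \<forall>e\<in>I. G \<inter> swap_edges F e \<noteq> {}})"
    using card_uniquely_embedded_swap_edges[OF assms(1,2) F_def refl IV] by (simp only: of_nat_le_iff)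
  also have "\<dots> = fact (card V) * real (card {G \<in> Pow (all_pairs V). \<forall>e\<in>I. G \<inter> swap_edges F e \<noteq> {}})" by simp
  also have "\<dots> \<le> fact (card V) * (2 ^ card (all_pairs V) * q powr (real (card V * (p - 1)) / real (8 * (d + 1))))"
    by (intro mult_left_mono Z) simp
  finally show ?thesis unfolding q_def .
qed

section \<open>Unique subgraphs\<close>

lemma edges_subset_all_pairs: "is_graph G \<Longrightarrow> edges G \<subseteq> all_pairs (verts G)"
  by (simp add: is_graph_def all_pairs_def)

lemma isomorphic_image:
  assumes "inj \<sigma>"
  shows "isomorphic G (\<sigma> ` verts G, (`) \<sigma> ` edges G)"
proof -
  have "{u, v} \<in> edges G \<longleftrightarrow> {\<sigma> u, \<sigma> v} \<in> (`) \<sigma> ` edges G" for u v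
    using inj_image_mem_iff[of "(`) \<sigma>" "{u, v}" "edges G"] assms by (simp add: inj_on_image)
  moreover have "bij_betw \<sigma> (verts G) (\<sigma> ` verts G)"
    using assms by (meson inj_on_imp_bij_betw inj_on_subset subset_UNIV)
  ultimately show ?thesis unfolding isomorphic_def by auto
qed

text \<open>If some vertex of the host graph is missed by a unique subgraph, then the subgraph has no isolated vertex, since that vertex could be
  moved. So the edge set determines the vertex set up to two choices, which gives the factor 2.\<close>

lemma card_unique_subgraph_classes_le:
  assumes H: "is_graph H"
  shows "card (unique_subgraph_classes H) \<le> 2 * card (unique_copies (verts H) (edges H))"
proof -
  define V where "V = verts H"
  define W where "W = unique_copies V (edges H)"
  \<comment> \<open>\<open>U\<close> represents the classes by the unique subgraphs inside
    \<open>H\<close> itself.\<close>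
  define U where "U = {S. is_subgraph S H \<and> (\<forall>S'. is_subgraph S' H \<and> isomorphic S' S \<longrightarrow> S' = S)}"
  have finV: "finite V" using H by (simp add: V_def is_graph_def)
  have EH: "edges H \<subseteq> all_pairs V" using edges_subset_all_pairs[OF H] by (simp add: V_def)
  have finW: "finite W"
  proof (rule finite_subset)
    show "W \<subseteq> Pow (all_pairs V)" using EH by (auto simp: W_def unique_copies_def)
  qed (use finite_all_pairs[OF finV] in simp)
  have fixed: "\<sigma> ` verts S = verts S" "(`) \<sigma> ` edges S = edges S"
    if S: "S \<in> U" and \<sigma>: "\<sigma> permutes V" "(`) \<sigma> ` edges S \<subseteq> edges H" for S \<sigma>
  proof -
    let ?S = "(\<sigma> ` verts S, (`) \<sigma> ` edges S)"
    have sub: "is_subgraph S H" using S by (simp add: U_def)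
    have "card (\<sigma> ` e) = card e" for e
      by (rule card_image) (meson \<sigma>(1) inj_on_subset permutes_inj subset_UNIV)
    then have "is_graph ?S" using sub by (auto simp: is_subgraph_def is_graph_def)
    moreover have "\<sigma> ` verts S \<subseteq> V"
      using sub permutes_image[OF \<sigma>(1)] image_mono[of "verts S" V \<sigma>] by (simp add: is_subgraph_def V_def)
    ultimately have "is_subgraph ?S H" using \<sigma>(2) by (simp add: is_subgraph_def V_def)
    moreover have "isomorphic ?S S" by (rule isomorphic_sym[OF isomorphic_image[OF permutes_inj[OF \<sigma>(1)]]])
    ultimately have "?S = S" using S unfolding U_def by blast
    then show "\<sigma> ` verts S = verts S" "(`) \<sigma> ` edges S = edges S" by (metis fst_conv, metis snd_conv)
  qed
  have U: "edges S \<in> W" "verts S = V \<or> verts S = \<Union> (edges S)" if S: "S \<in> U" for S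
  proof -
    have sub: "is_graph S" "verts S \<subseteq> V" "edges S \<subseteq> edges H"
      using S by (auto simp: U_def is_subgraph_def V_def)
    have eS: "\<Union> (edges S) \<subseteq> verts S" using sub(1) by (auto simp: is_graph_def)
    show "edges S \<in> W" using sub(3) fixed(2)[OF S] by (auto simp: W_def unique_copies_def embeddings_def)
    show "verts S = V \<or> verts S = \<Union> (edges S)"
    proof (rule ccontr)
      assume "\<not> ?thesis"
      then obtain v w where vw: "v \<in> verts S" "v \<notin> \<Union> (edges S)" "w \<in> V" "w \<notin> verts S"
        using sub(2) eS by blast
      \<comment> \<open>Exchanging the isolated vertex \<open>v\<close> with the missing vertex
        \<open>w\<close> fixes every edge of \<open>S\<close> but changes its vertex set.\<close>
      let ?t = "transpose v w"
      have t: "?t permutes V" using vw sub(2) by (intro permutes_swap_id) auto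
      have "?t ` e = e" if "e \<in> edges S" for e
      proof -
        have "v \<notin> e" "w \<notin> e" using that vw eS by blast+
        then have "?t x = x" if "x \<in> e" for x using that by (metis transpose_apply_other)
        then show ?thesis by simp
      qed
      then have "(`) ?t ` edges S = edges S" by simp
      then have "?t ` verts S = verts S" using fixed(1)[OF S t] sub(3) by simp
      moreover have "w \<in> ?t ` verts S" using vw(1) by (metis imageI transpose_apply_first)
      ultimately show False using vw(4) by simp
    qed
  qed
  have U_sub: "U \<subseteq> (\<lambda>E. (V, E)) ` W \<union> (\<lambda>E. (\<Union> E, E)) ` W"
  proof
    fix S assume "S \<in> U"
    then show "S \<in> (\<lambda>E. (V, E)) ` W \<union> (\<lambda>E. (\<Union> E, E)) ` W"
      using U[of S] by (cases S) auto
  qed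
  have finU: "finite U" by (rule finite_subset[OF U_sub]) (use finW in simp)
  have "unique_subgraph_classes H \<subseteq> (\<lambda>S. iso_rel `` {S}) ` U"
  proof
    fix C assume "C \<in> unique_subgraph_classes H"
    then obtain G where G: "is_graph G" "G \<subseteq>\<^sup>* H" "C = iso_rel `` {G}"
      unfolding unique_subgraph_classes_def by (auto elim: quotientE)
    then obtain S where S: "is_subgraph S H" "isomorphic S G"
      and uniq: "\<And>S'. is_subgraph S' H \<Longrightarrow> isomorphic S' G \<Longrightarrow> S' = S"
      unfolding unique_subgraph_def by blast
    have "S' = S" if "is_subgraph S' H" "isomorphic S' S" for S'
      by (rule uniq[OF that(1) isomorphic_trans[OF that(2) S(2)]])
    then have "S \<in> U" using S(1) unfolding U_def by blast
    have "(S, G) \<in> iso_rel" using S G(1) by (simp add: iso_rel_def is_subgraph_def)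
    then have "iso_rel `` {S} = iso_rel `` {G}" by (rule equiv_class_eq[OF equiv_iso_rel])
    then show "C \<in> (\<lambda>S. iso_rel `` {S}) ` U" using G(3) \<open>S \<in> U\<close> by blast
  qed
  then have "card (unique_subgraph_classes H) \<le> card U" by (rule surj_card_le[OF finU])
  also have "\<dots> \<le> card ((\<lambda>E. (V, E)) ` W \<union> (\<lambda>E. (\<Union> E, E)) ` W)"
    using U_sub finW by (intro card_mono) auto
  also have "\<dots> \<le> card ((\<lambda>E. (V, E)) ` W) + card ((\<lambda>E. (\<Union> E, E)) ` W)" by (rule card_Un_le)
  also have "\<dots> \<le> card W + card W" by (intro add_mono card_image_le finW)
  finally show ?thesis by (simp add: W_def V_def)
qed

section \<open>Asymptotic estimates and the limit\<close>

lemma automorphism_term_tendsto_0: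
  "(\<lambda>n. (1 + real n * 2 powr (- (real (n - 2) / 6))) ^ n - 1) \<longlonglongrightarrow> 0"
proof -
  \<comment> \<open>The base is \<open>1 + o(1 / n)\<close>. Real subtraction and real powers suit
    \<open>real_asymp\<close>; they agree with the truncated subtraction for
    \<open>n \<ge> 2\<close>.\<close>
  have "(\<lambda>n::nat. (1 + real n * 2 powr (- ((real n - 2) / 6))) powr real n - 1) \<longlonglongrightarrow> 0"
    by real_asymp
  moreover have "\<forall>\<^sub>F n in sequentially. (1 + real n * 2 powr (- ((real n - 2) / 6))) powr real n - 1
      = (1 + real n * 2 powr (- (real (n - 2) / 6))) ^ n - 1"
    using eventually_ge_at_top[of 2]
  proof eventually_elim
    case (elim n)
    have "1 + real n * 2 powr (- ((real n - 2) / 6)) > 0" by (intro add_pos_nonneg) auto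
    then show ?case using elim by (simp add: powr_realpow of_nat_diff)
  qed
  ultimately show ?thesis by (rule Lim_transform_eventually)
qed

text \<open>The 2 comes from the two possible vertex sets for an edge set; the 4 combines it with
  the 2 in the count of nontrivial automorphisms.\<close>

lemma unique_subgraph_ratio_le:
  assumes H: "is_graph H" and n: "card (verts H) = n" "n \<ge> 2"
  shows "unique_subgraph_ratio H \<le> 2 * (card (uniquely_embedded (verts H) (edges H)) / 2 ^ (n choose 2))
    + 4 * ((1 + n * 2 powr (- (real (n - 2) / 6))) ^ n - 1)"
proof -
  define V where "V = verts H"
  define N where "N = n choose 2"
  define B where "B = (1 + n * 2 powr (- (real (n - 2) / 6))) ^ n - 1"
  have V: "finite V" "card V = n" "card (all_pairs V) = N"
    using H n card_all_pairs[of V] by (simp_all add: V_def N_def is_graph_def)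
  let ?A = "card (uniquely_embedded V (edges H))"
  let ?s = "\<lambda>\<sigma>. card {G \<in> Pow (all_pairs V). (`) \<sigma> ` G = G}"
  have EH: "edges H \<subseteq> all_pairs V" using edges_subset_all_pairs[OF H] by (simp add: V_def)
  have "real (fact n * card (unique_subgraph_classes H))
      \<le> real (fact n * (2 * card (unique_copies V (edges H))))"
    using card_unique_subgraph_classes_le[OF H] by (simp add: V_def)
  also have "\<dots> = 2 * real (fact n * card (unique_copies V (edges H)))" by simp
  also have "real (fact n * card (unique_copies V (edges H)))
      \<le> real (?A + 2 * (\<Sum>\<sigma> | \<sigma> permutes V \<and> \<sigma> \<noteq> id. ?s \<sigma>))"
    using fact_mult_card_unique_copies[OF V(1) EH] unfolding V(2) by (simp only: of_nat_le_iff)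
  also have "2 * real (?A + 2 * (\<Sum>\<sigma> | \<sigma> permutes V \<and> \<sigma> \<noteq> id. ?s \<sigma>)) = 2 * ?A + 4 * (\<Sum>\<sigma> | \<sigma> permutes V \<and> \<sigma> \<noteq> id. real (?s \<sigma>))" by simp
  also have "\<dots> \<le> 2 * ?A + 4 * (2 ^ N * B)"
    using sum_invariant_nonidentity[of V] V n(2) by (intro add_left_mono mult_left_mono) (simp_all add: B_def)
  finally have "fact n * real (card (unique_subgraph_classes H)) \<le> 2 * ?A + 4 * (2 ^ N * B)" by simp
  then have "fact n * real (card (unique_subgraph_classes H)) / 2 ^ N \<le> (2 * ?A + 4 * (2 ^ N * B)) / 2 ^ N"
    by (rule divide_right_mono) simp
  also have "\<dots> = 2 * (?A / 2 ^ N) + 4 * B" by (simp add: add_divide_distrib)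
  finally have "unique_subgraph_ratio H \<le> 2 * (?A / 2 ^ N) + 4 * B"
    unfolding unique_subgraph_ratio_def n(1) N_def[symmetric] by (simp add: mult.commute)
  then show ?thesis by (simp add: V_def N_def B_def)
qed

text \<open>With about \<open>(ln n)^2\<close> petals the exponent is of order
  \<open>n * (ln n)^2\<close>, which beats \<open>fact n \<le> exp (n * ln n)\<close>, while the
  sunflower threshold stays polylogarithmic. The null sequence \<open>s\<close> is uniform over all
  host graphs.\<close>

lemma sparse_complement_tendsto_0:
  assumes "K \<ge> 1"
  shows "\<exists>s. s \<longlonglongrightarrow> (0 :: real) \<and> (\<forall>\<^sub>F n in sequentially. s n \<ge> 0 \<and> (\<forall>(V :: 'a set) H. finite V \<longrightarrow> card V = n \<longrightarrow>
    H \<subseteq> all_pairs V \<longrightarrow> card (all_pairs V - H) \<le> K * n \<longrightarrow> card (uniquely_embedded V H) / 2 ^ (n choose 2) \<le> s n))"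
proof -
  define d where "d = 4 * K"
  define q :: real where "q = 1 - 1 / 2 ^ (2 * d)"
  \<comment> \<open>The added 1 compensates for the factor \<open>p - 1\<close> in the exponent and
    ensures \<open>p n \<ge> 1\<close>.\<close>
  define p where "p n = nat \<lceil>(ln (real n))\<^sup>2\<rceil> + 1" for n
  define a where "a = - ln q / (8 * (d + 1))"
  define s where "s n = exp (real n * ln (real n) - a * (real n * (ln (real n))\<^sup>2))" for n
  have "1 / 2 ^ (2 * d) < (1 :: real)" using assms by (simp add: d_def one_less_power)
  then have q: "0 < q" "q < 1" by (simp_all add: q_def)
  then have "a > 0" unfolding a_def by (intro divide_pos_pos) simp_all
  then have "s \<longlonglongrightarrow> 0" unfolding s_def by real_asymp
  define C where "C = 4 * real (d + 1) * real (d + 1) ^ (d + 1)"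
  have "C > 0" by (simp add: C_def)
  \<comment> \<open>The 2 covers the rounding up and the added 1 in \<open>p n\<close>.\<close>
  have "(\<lambda>n. ((ln (real n))\<^sup>2 + 2) powr c / real n) \<longlonglongrightarrow> 0" if "c > 0" for c
    using that by real_asymp
  from this[of "real (d + 1)"]
  have "\<forall>\<^sub>F n in sequentially. ((ln (real n))\<^sup>2 + 2) powr real (d + 1) / real n < 1 / C"
    by (rule order_tendstoD) (use \<open>C > 0\<close> in simp_all)
  then have "\<forall>\<^sub>F n in sequentially. 4 * (d + 1) * (p n * (d + 1)) ^ (d + 1) \<le> n \<and> n \<ge> 1"
    using eventually_ge_at_top[of 1]
  proof eventually_elim
    case (elim n)
    let ?y = "(ln (real n))\<^sup>2 + 2"
    have y: "?y > 0" by (simp add: add_nonneg_pos)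
    have "real (nat \<lceil>(ln (real n))\<^sup>2\<rceil>) = real_of_int \<lceil>(ln (real n))\<^sup>2\<rceil>" by simp
    then have p: "real (p n) \<le> ?y" unfolding p_def of_nat_add by linarith
    have "real (4 * (d + 1) * (p n * (d + 1)) ^ (d + 1)) = C * real (p n) ^ (d + 1)"
      by (simp only: C_def power_mult_distrib of_nat_mult of_nat_power of_nat_numeral mult_ac)
    also have "\<dots> \<le> C * ?y ^ (d + 1)" using p \<open>C > 0\<close> by (intro mult_left_mono power_mono) auto
    also have "?y ^ (d + 1) = ?y powr real (d + 1)" by (rule powr_realpow[OF y, symmetric])
    also have "C * \<dots> \<le> n" using elim \<open>C > 0\<close> by (simp add: field_simps)
    finally show ?case using elim(2) by (simp only: of_nat_le_iff)
  qed
  then have "\<forall>\<^sub>F n in sequentially. s n \<ge> 0 \<and> (\<forall>(V :: 'a set) H. finite V \<longrightarrow> card V = n \<longrightarrow>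
    H \<subseteq> all_pairs V \<longrightarrow> card (all_pairs V - H) \<le> K * n \<longrightarrow> card (uniquely_embedded V H) / 2 ^ (n choose 2) \<le> s n)"
  proof eventually_elim
    case (elim n)
    let ?t = "real (n * (p n - 1)) / real (8 * (d + 1))"
    have "fact n \<le> real (n ^ n)" by (rule fact_le_power)
    also have "\<dots> = exp (real n * ln (real n))" using elim by (simp flip: powr_realpow add: powr_def)
    finally have f: "fact n \<le> exp (real n * ln (real n))" .
    have "real (p n - 1) \<ge> (ln (real n))\<^sup>2" unfolding p_def by (simp add: real_nat_ceiling_ge)
    then have "real n * (ln (real n))\<^sup>2 \<le> real (n * (p n - 1))" by (simp add: mult_left_mono)
    then have "a * (real n * (ln (real n))\<^sup>2) \<le> a * real (n * (p n - 1))"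
      using \<open>a > 0\<close> by (intro mult_left_mono) auto
    also have "\<dots> = - (?t * ln q)" by (simp add: a_def)
    finally have "q powr ?t \<le> exp (- (a * (real n * (ln (real n))\<^sup>2)))"
      using q by (simp add: powr_def)
    then have "fact n * q powr ?t \<le> exp (real n * ln (real n)) * exp (- (a * (real n * (ln (real n))\<^sup>2)))"
      using f by (intro mult_mono) auto
    also have "\<dots> = s n" by (simp add: s_def flip: exp_add)
    finally have le: "fact n * q powr ?t \<le> s n" .
    have "card (uniquely_embedded V H) / 2 ^ (n choose 2) \<le> s n"
      if V: "finite V" "card V = n" "H \<subseteq> all_pairs V" "card (all_pairs V - H) \<le> K * n" for V :: "'a set" and H
    proof -
      have "real (card (uniquely_embedded V H)) \<le> fact n * (2 ^ (n choose 2) * q powr ?t)"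
        using card_uniquely_embedded_sparse_complement[OF V(1,3), of K d "p n"] V elim assms
        by (simp add: d_def q_def p_def card_all_pairs)
      then have "card (uniquely_embedded V H) / 2 ^ (n choose 2) \<le> fact n * q powr ?t"
        by (simp add: field_simps)
      then show ?thesis using le by simp
    qed
    then show ?case by (simp add: s_def)
  qed
  then show ?thesis using \<open>s \<longlonglongrightarrow> 0\<close> by blast
qed

text \<open>More than \<open>K * n\<close> pivotal edges per graph stand against an average of at
  most \<open>sqrt (n choose 2) \<le> n\<close>.\<close>

lemma card_uniquely_embedded_dense_complement:
  assumes "finite V" "card V = n" "H \<subseteq> all_pairs V" "card (all_pairs V - H) > K * n" "K \<ge> 1" "n \<ge> 1"
  shows "card (uniquely_embedded V H) / 2 ^ (n choose 2) \<le> 1 / K"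
proof -
  let ?A = "card (uniquely_embedded V H)"
  have "real (n choose 2) \<le> (real n)\<^sup>2"
  proof -
    have "n choose 2 \<le> n * (n - 1)" by (simp add: choose_two)
    also have "\<dots> \<le> n\<^sup>2" by (simp add: power2_eq_square)
    finally show ?thesis by (simp flip: of_nat_power)
  qed
  then have "sqrt (n choose 2) \<le> n" by (intro real_le_lsqrt) auto
  then have s: "sqrt (n choose 2) * 2 ^ (n choose 2) \<le> real n * 2 ^ (n choose 2)" by (rule mult_right_mono) simp
  have "real ?A * real (K * n) \<le> real ?A * card (all_pairs V - H)"
    using assms(4) by (intro mult_left_mono) (simp_all del: of_nat_mult)
  also have "\<dots> \<le> sqrt (n choose 2) * 2 ^ (n choose 2)"
    using card_uniquely_embedded_mult_complement[OF assms(1,3)] assms(1,2) by (simp add: card_all_pairs)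
  also note s
  finally have "real n * (real ?A * real K) \<le> real n * 2 ^ (n choose 2)" by (simp add: mult_ac)
  then have "real ?A * real K \<le> 2 ^ (n choose 2)" using assms(6) by simp
  then show ?thesis using assms(5) by (simp add: field_simps)
qed

theorem theorem1p2:
  shows "max_unique_subgraph_ratio \<longlonglongrightarrow> 0"
proof (rule LIMSEQ_I)
  fix \<epsilon> :: real assume "\<epsilon> > 0"
  \<comment> \<open>The dense case enters the ratio as \<open>2 / K\<close>, which this choice puts
    below \<open>\<epsilon> / 2\<close>.\<close>
  then obtain K :: nat where K: "real K > 4 / \<epsilon>" using reals_Archimedean2 by blast
  then have "real K > 0" using \<open>\<epsilon> > 0\<close> by (meson divide_pos_pos less_trans zero_less_numeral)
  then have "K \<ge> 1" by simp
  have Keps: "2 / K < \<epsilon> / 2" using K \<open>\<epsilon> > 0\<close> \<open>real K > 0\<close> by (simp add: field_simps)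
  define B where "B n = (1 + real n * 2 powr (- (real (n - 2) / 6))) ^ n - 1" for n
  obtain s where "s \<longlonglongrightarrow> (0 :: real)" and s: "\<forall>\<^sub>F n in sequentially. s n \<ge> 0 \<and> (\<forall>(V :: nat set) H. finite V \<longrightarrow> card V = n \<longrightarrow>
    H \<subseteq> all_pairs V \<longrightarrow> card (all_pairs V - H) \<le> K * n \<longrightarrow> card (uniquely_embedded V H) / 2 ^ (n choose 2) \<le> s n)"
    using sparse_complement_tendsto_0[OF \<open>K \<ge> 1\<close>] by blast
  have "(\<lambda>n. 2 * s n + 4 * B n) \<longlonglongrightarrow> 2 * 0 + 4 * 0"
    unfolding B_def by (intro tendsto_intros \<open>s \<longlonglongrightarrow> 0\<close> automorphism_term_tendsto_0)
  then have "\<forall>\<^sub>F n in sequentially. 2 * s n + 4 * B n < \<epsilon> / 2"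
    by (rule order_tendstoD) (use \<open>\<epsilon> > 0\<close> in simp)
  with s eventually_ge_at_top[of 2]
  have "\<forall>\<^sub>F n in sequentially. norm (max_unique_subgraph_ratio n - 0) < \<epsilon>"
  proof eventually_elim
    case (elim n)
    have "max_unique_subgraph_ratio n \<in> {unique_subgraph_ratio H | H. is_graph H \<and> card (verts H) = n}"
      unfolding max_unique_subgraph_ratio_def
      by (rule Max_in[OF unique_subgraph_ratios_finite unique_subgraph_ratios_nonempty])
    then obtain H where H: "is_graph H" "card (verts H) = n" "max_unique_subgraph_ratio n = unique_subgraph_ratio H"
      by blast
    let ?A = "card (uniquely_embedded (verts H) (edges H))"
    have V: "finite (verts H)" "edges H \<subseteq> all_pairs (verts H)"
      using H(1) edges_subset_all_pairs[OF H(1)] by (simp_all add: is_graph_def)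
    \<comment> \<open>The sum covers both cases, since each summand is nonnegative.\<close>
    have "?A / 2 ^ (n choose 2) \<le> s n + 1 / K"
    proof (cases "card (all_pairs (verts H) - edges H) \<le> K * n")
      case True
      then have "?A / 2 ^ (n choose 2) \<le> s n" using elim(1) V H(2) by blast
      then show ?thesis by (simp add: add_increasing2)
    next
      case False
      then have "?A / 2 ^ (n choose 2) \<le> 1 / K"
        using elim(2) \<open>K \<ge> 1\<close> by (intro card_uniquely_embedded_dense_complement[OF V(1) H(2) V(2)]) auto
      then show ?thesis using elim(1) by simp
    qed
    then have "unique_subgraph_ratio H \<le> 2 * (s n + 1 / K) + 4 * B n"
      using unique_subgraph_ratio_le[OF H(1,2) elim(2)] by (simp add: B_def)
    also have "\<dots> < \<epsilon>" using elim(3) Keps by simp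
    finally have "unique_subgraph_ratio H < \<epsilon>" .
    moreover have "unique_subgraph_ratio H \<ge> 0" by (simp add: unique_subgraph_ratio_def)
    ultimately show ?case using H(3) by simp
  qed
  then show "\<exists>no. \<forall>n\<ge>no. norm (max_unique_subgraph_ratio n - 0) < \<epsilon>"
    by (simp add: eventually_sequentially)
qed

end
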